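(* Suppose $X$ is a separable Banach function space on $\mathbb{T}$. If the Hardy-Littlewood maximal operator $M$ is bounded on the associate space $X'$, then the set of analytic polynomials $\mathcal{P}_A$ is dense in the abstract Hardy space $H[X]$ (with respect to the norm of $X$).
   Context: $\mathbb{T}=\{z\in\mathbb{C}:|z|=1\}$ is equipped with the normalized Lebesgue measure $dm(t)=|dt|/(2\pi)$. $L^0$ is the space of all measurable complex-valued functions on $\mathbb{T}$ (functions equal a.e. are identified), $L^0_+$ is the set of measurable functions on $\mathbb{T}$ with values in $[0,\infty]$, $L^1=L^1(\mathbb{T})$, and $\chi_E$ is the characteristic function of $E$. A mapping $\rho:L^0_+\to[0,\infty]$ is called a Banach function norm if for all $f,g,f_n\in L^0_+$ ($n\in\mathbb{N}$), all constants $a\ge 0$ and all measurable $E\subset\mathbb{T}$: (A1) $\rho(f)=0\Leftrightarrow f=0$ a.e., $\rho(af)=a\rho(f)$, $\rho(f+g)\le\rho(f)+\rho(g)$; (A2) $0\le g\le f$ a.e. $\Rightarrow\rho(g)\le\rho(f)$; (A3) $0\le f_n\uparrow f$ a.e. $\Rightarrow\rho(f_n)\uparrow\rho(f)$; (A4) $m(E)<\infty\Rightarrow\rho(\chi_E)<\infty$; (A5) $\int_E f\,dm\le C_E\,\rho(f)$ with a constant $C_E\in(0,\infty)$ that may depend on $E$ and $\rho$ but not on $f$. The set $X$ of all $f\in L^0$ with $\rho(|f|)<\infty$, with norm $\|f\|_X:=\rho(|f|)$, is called a Banach function space on $\mathbb{T}$; it is a Banach space. The associate norm is $\rho'(g):=\sup\{\int_{\mathbb{T}}f(t)g(t)\,dm(t):f\in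 L^0_+,\ \rho(f)\le1\}$, $g\in L^0_+$; it is again a Banach function norm, and the Banach function space $X'$ it determines is called the associate space of $X$. For $f\in L^1$, the Hardy-Littlewood maximal function is $(Mf)(t):=\sup_{I\ni t}\frac1{m(I)}\int_I|f(\tau)|\,dm(\tau)$, $t\in\mathbb{T}$, the supremum being over all arcs $I\subset\mathbb{T}$ containing $t$. $M$ is bounded on $X'$ if there is a constant $c<\infty$ with $\|Mg\|_{X'}\le c\|g\|_{X'}$ for all $g\in X'$ (note $X'\subset L^1$). For $f\in L^1$, $\widehat f(n):=\frac1{2\pi}\int_{-\pi}^{\pi}f(e^{i\varphi})e^{-in\varphi}\,d\varphi$, $n\in\mathbb{Z}$. The abstract Hardy space built upon $X$ is $H[X]:=\{f\in X:\widehat f(n)=0\text{ for all }n<0\}$. $\mathcal{P}_A$ is the set of analytic polynomials, i.e. functions $q(t)=\sum_{k=0}^n\alpha_kt^k$, $t\in\mathbb{T}$, with $\alpha_0,\dots,\alpha_n\in\mathbb{C}$. *)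

theory Defs
  imports "HOL-Probability.Probability" "HOL-Computational_Algebra.Polynomial"
begin

text \<open>
  Functions on the unit circle are functions on \<^typ>\<open>complex\<close> whose values off
  \<^term>\<open>sphere (0::complex) 1\<close> are irrelevant, and a.e. equivalence classes are handled through
  representatives: everything below is invariant under a.e. equality on the circle.
\<close>

text \<open>Normalized Lebesgue measure, on the Lebesgue (not just Borel) measurable subsets of the circle.\<close>

definition circle_measure :: "complex measure" where
  "circle_measure =
     completion (distr (uniform_measure lborel {-pi<..pi}) (restrict_space borel (sphere 0 1)) cis)"

definition L0 :: "(complex \<Rightarrow> complex) set" where
  "L0 = borel_measurable circle_measure"

definition L0_plus :: "(complex \<Rightarrow> ennreal) set" where
  "L0_plus = borel_measurable circle_measure"

text \<open>
  \<^term>\<open>\<rho>\<close> is a total function in HOL, but only its values on \<^const>\<open>L0_plus\<close> are ever used.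
\<close>

locale banach_function_norm =
  fixes \<rho> :: "(complex \<Rightarrow> ennreal) \<Rightarrow> ennreal"
  assumes zero_iff: "f \<in> L0_plus \<Longrightarrow> \<rho> f = 0 \<longleftrightarrow> (AE t in circle_measure. f t = 0)"
    and homogeneous: "f \<in> L0_plus \<Longrightarrow> 0 \<le> a \<Longrightarrow> \<rho> (\<lambda>t. ennreal a * f t) = ennreal a * \<rho> f"
    and triangle: "f \<in> L0_plus \<Longrightarrow> g \<in> L0_plus \<Longrightarrow> \<rho> (\<lambda>t. f t + g t) \<le> \<rho> f + \<rho> g"
    and lattice: "f \<in> L0_plus \<Longrightarrow> g \<in> L0_plus \<Longrightarrow> (AE t in circle_measure. g t \<le> f t) \<Longrightarrow> \<rho> g \<le> \<rho> f"
    and fatou: "(\<And>n::nat. F n \<in> L0_plus) \<Longrightarrow> f \<in> L0_plus \<Longrightarrow>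
        (AE t in circle_measure. incseq (\<lambda>n. F n t) \<and> (\<lambda>n. F n t) \<longlonglongrightarrow> f t) \<Longrightarrow>
        incseq (\<lambda>n. \<rho> (F n)) \<and> (\<lambda>n. \<rho> (F n)) \<longlonglongrightarrow> \<rho> f"
    and finite_indicator: "E \<in> sets circle_measure \<Longrightarrow> emeasure circle_measure E < \<infinity> \<Longrightarrow>
        \<rho> (indicator E) < \<infinity>"
    and integral_bound: "E \<in> sets circle_measure \<Longrightarrow>
        \<exists>C::real. C > 0 \<and> (\<forall>f\<in>L0_plus. (\<integral>\<^sup>+t\<in>E. f t \<partial>circle_measure) \<le> ennreal C * \<rho> f)"

definition bfs_norm :: "((complex \<Rightarrow> ennreal) \<Rightarrow> ennreal) \<Rightarrow> (complex \<Rightarrow> complex) \<Rightarrow> ennreal" where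
  "bfs_norm \<rho> f = \<rho> (\<lambda>t. ennreal (cmod (f t)))"

definition bfs :: "((complex \<Rightarrow> ennreal) \<Rightarrow> ennreal) \<Rightarrow> (complex \<Rightarrow> complex) set" where
  "bfs \<rho> = {f \<in> L0. bfs_norm \<rho> f < \<infinity>}"

definition bfs_dense ::
  "((complex \<Rightarrow> ennreal) \<Rightarrow> ennreal) \<Rightarrow> (complex \<Rightarrow> complex) set \<Rightarrow> (complex \<Rightarrow> complex) set \<Rightarrow> bool" where
  "bfs_dense \<rho> D Y \<longleftrightarrow>
     D \<subseteq> Y \<and> (\<forall>f\<in>Y. \<forall>\<epsilon>::real. \<epsilon> > 0 \<longrightarrow> (\<exists>d\<in>D. bfs_norm \<rho> (\<lambda>t. f t - d t) < ennreal \<epsilon>))"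

definition bfs_separable :: "((complex \<Rightarrow> ennreal) \<Rightarrow> ennreal) \<Rightarrow> bool" where
  "bfs_separable \<rho> \<longleftrightarrow> (\<exists>D. countable D \<and> bfs_dense \<rho> D (bfs \<rho>))"

definition associate_norm :: "((complex \<Rightarrow> ennreal) \<Rightarrow> ennreal) \<Rightarrow> (complex \<Rightarrow> ennreal) \<Rightarrow> ennreal" where
  "associate_norm \<rho> g = (\<Squnion>f\<in>{f \<in> L0_plus. \<rho> f \<le> 1}. \<integral>\<^sup>+t. f t * g t \<partial>circle_measure)"

text \<open>
  All nondegenerate arcs (open, closed, half-open); intervals longer than \<^term>\<open>2 * pi\<close> give the
  whole circle. Every arc is measurable with positive measure.
\<close>

definition circle_arcs :: "complex set set" where
  "circle_arcs = {cis ` J |J. is_interval J \<and> interior J \<noteq> {}}"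

definition hl_maximal :: "(complex \<Rightarrow> complex) \<Rightarrow> complex \<Rightarrow> ennreal" where
  "hl_maximal f t = (\<Squnion>I\<in>{I \<in> circle_arcs. t \<in> I}.
     (\<integral>\<^sup>+\<tau>\<in>I. ennreal (cmod (f \<tau>)) \<partial>circle_measure) / emeasure circle_measure I)"

text \<open>
  \<^term>\<open>hl_maximal g\<close> takes values in \<open>[0,\<infinity>]\<close>, so its norm is the function norm itself.
\<close>

definition hl_maximal_bounded :: "((complex \<Rightarrow> ennreal) \<Rightarrow> ennreal) \<Rightarrow> bool" where
  "hl_maximal_bounded \<rho> \<longleftrightarrow> (\<exists>c<\<infinity>. \<forall>g\<in>bfs \<rho>. \<rho> (hl_maximal g) \<le> c * bfs_norm \<rho> g)"

text \<open>
  The integral must be over \<^const>\<open>lebesgue\<close>: for a Lebesgue measurable \<open>f\<close> the integrand need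
  not be Borel measurable, and the integral over \<^const>\<open>lborel\<close> would then be 0 by convention.
\<close>

definition fourier_coeff :: "(complex \<Rightarrow> complex) \<Rightarrow> int \<Rightarrow> complex" where
  "fourier_coeff f n =
     1 / (2 * pi) * (LINT \<phi>:{-pi..pi}|lebesgue. f (cis \<phi>) * exp (- \<i> * of_int n * of_real \<phi>))"

definition hardy_space :: "((complex \<Rightarrow> ennreal) \<Rightarrow> ennreal) \<Rightarrow> (complex \<Rightarrow> complex) set" where
  "hardy_space \<rho> = {f \<in> bfs \<rho>. \<forall>n<0. fourier_coeff f n = 0}"

definition analytic_polynomials :: "(complex \<Rightarrow> complex) set" where
  "analytic_polynomials = range poly"

end

theory Submission
  imports Defs "HOL-Real_Asymp.Real_Asymp"
begin

text \<open>
  Convolution \<open>f \<mapsto> f * V\<^sub>n\<close> with the de la Vallee Poussin kernel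
  \<open>V\<^sub>n(e\<^sup>i\<^sup>\<theta>) = 2\<^sup>n (1 + cos \<theta>)\<^sup>n / (2n choose n)\<close>, a nonnegative trigonometric polynomial of
  mean 1, maps the Hardy space into analytic polynomials, so it suffices that \<open>f * V\<^sub>n \<rightarrow> f\<close> in \<open>X\<close>.
  Since \<open>V\<^sub>n\<close> is even and decreasing in \<open>\<bar>\<theta>\<bar>\<close>, \<open>\<bar>g\<bar> * V\<^sub>n \<le> M g\<close>; boundedness of \<open>M\<close> on \<open>X'\<close>
  and the Lorentz--Luxemburg theorem \<open>X'' = X\<close> bound these convolutions uniformly on \<open>X\<close>.
  A separable \<open>X\<close> has absolutely continuous norm, so dominated convergence holds in \<open>X\<close>
  and trigonometric polynomials, on which convergence is elementary, are dense.
\<close>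

section \<open>The circle measure and Fourier coefficients\<close>

text \<open>This kernel is chosen because its superlevel sets are arcs around the centre; the Fejer
  kernel has side lobes, so its superlevel sets need not be arcs. Its Fourier multipliers are ratios
  of binomial coefficients, whose limit 1 is elementary. The maximal function takes its place, but
  it is controlled on X' and not on X, so the estimate has to be transported by duality. Each
  convolution with V_n is bounded, hence the second associate norm is needed only on bounded
  functions, and there the separating functional comes from a projection in L2 instead of the
  Hahn-Banach theorem. The circle carries a complete measure, so a measurable function need not be
  Borel; composition with \<open>cis\<close> therefore goes through a Borel representative.\<close>

definition circle_borel :: "complex measure" where
  "circle_borel = distr (uniform_measure lborel {-pi<..pi}) (restrict_space borel (sphere 0 1)) cis"

lemma circle_measure_eq: "circle_measure = completion circle_borel"
  by (simp add: circle_measure_def circle_borel_def)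

lemma sets_circle_borel: "sets circle_borel = sets (restrict_space borel (sphere 0 1))"
  by (simp add: circle_borel_def)

lemma space_circle_measure [simp]: "space circle_measure = sphere 0 1" "space circle_borel = sphere 0 1"
  by (auto simp: circle_measure_eq circle_borel_def space_restrict_space)

lemma cis_measurable [measurable]: "cis \<in> borel_measurable borel"
  by (intro borel_measurable_continuous_onI continuous_on_cis continuous_on_id)

lemma cis_measurable_sphere: "cis \<in> measurable (uniform_measure lborel {-pi<..pi}) (restrict_space borel (sphere 0 1))"
  by (intro measurable_restrict_space2) auto

lemma prob_space_uniform_interval: "prob_space (uniform_measure lborel {-pi<..pi})"
  by (intro prob_space_uniform_measure) auto

lemma prob_space_circle_borel: "prob_space circle_borel"
  unfolding circle_borel_def
  by (intro prob_space.prob_space_distr prob_space_uniform_interval cis_measurable_sphere)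

lemma prob_space_circle_measure: "prob_space circle_measure"
proof
  have "emeasure circle_borel (sphere 0 1) = 1"
    using prob_space.emeasure_space_1[OF prob_space_circle_borel] by simp
  moreover have "sphere 0 1 \<in> sets circle_borel"
    using sets.top[of circle_borel] by simp
  ultimately show "emeasure circle_measure (space circle_measure) = 1"
    by (simp add: circle_measure_eq)
qed

interpretation cm: prob_space circle_measure
  by (rule prob_space_circle_measure)

lemma borel_measurable_circle_measureI:
  "f \<in> borel_measurable circle_borel \<Longrightarrow> f \<in> borel_measurable circle_measure"
  unfolding circle_measure_eq by (rule measurable_completion)

lemma borel_imp_circle_borel:
  "f \<in> borel_measurable borel \<Longrightarrow> f \<in> borel_measurable circle_borel"
  unfolding measurable_cong_sets[OF sets_circle_borel refl] by (rule measurable_restrict_space1)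

lemma borel_imp_circle_measure:
  "f \<in> borel_measurable borel \<Longrightarrow> f \<in> borel_measurable circle_measure"
  by (intro borel_measurable_circle_measureI borel_imp_circle_borel)

text \<open>A Borel representative is what can be composed with \<open>cis\<close> and integrated
  over \<open>lborel\<close>. Real and imaginary parts get their representatives separately.\<close>

lemma ex_circle_borel:
  fixes f :: "complex \<Rightarrow> complex"
  assumes "f \<in> borel_measurable circle_measure"
  obtains g where "g \<in> borel_measurable circle_borel" "AE t in circle_borel. f t = g t"
proof -
  have "(\<lambda>t. Re (f t)) \<in> borel_measurable (completion circle_borel)"
       "(\<lambda>t. Im (f t)) \<in> borel_measurable (completion circle_borel)"
    using assms unfolding circle_measure_eq by auto
  then obtain a b where a[measurable]: "a \<in> borel_measurable circle_borel" "AE t in circle_borel. Re (f t) = a t"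
    and b[measurable]: "b \<in> borel_measurable circle_borel" "AE t in circle_borel. Im (f t) = b t"
    using completion_ex_borel_measurable_real by metis
  show ?thesis
  proof
    have of_real_m: "complex_of_real \<in> borel_measurable borel"
      by (intro borel_measurable_continuous_onI continuous_intros)
    show "(\<lambda>t. Complex (a t) (b t)) \<in> borel_measurable circle_borel"
      unfolding Complex_eq by (intro borel_measurable_add borel_measurable_times measurable_compose[OF a(1) of_real_m] measurable_compose[OF b(1) of_real_m] borel_measurable_const a(1) b(1))
    show "AE t in circle_borel. f t = Complex (a t) (b t)"
      using a(2) b(2) by eventually_elim (auto simp: complex_eq_iff)
  qed
qed

lemma measurable_comp_cis:
  assumes "g \<in> borel_measurable circle_borel"
  shows "(\<lambda>x. g (cis x)) \<in> borel_measurable lborel"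
proof -
  have "cis \<in> measurable lborel (restrict_space borel (sphere 0 1))"
    by (intro measurable_restrict_space2) auto
  moreover have "g \<in> borel_measurable (restrict_space borel (sphere 0 1))"
    using assms by (simp add: measurable_cong_sets[OF sets_circle_borel refl])
  ultimately show ?thesis by (rule measurable_compose)
qed

lemma integral_circle_borel:
  fixes g :: "complex \<Rightarrow> complex"
  assumes g: "g \<in> borel_measurable circle_borel"
  shows "integral\<^sup>L circle_borel g = 1 / (2 * pi) * (LINT \<phi>:{-pi..pi}|lebesgue. g (cis \<phi>))"
proof -
  have g': "g \<in> borel_measurable (restrict_space borel (sphere 0 1))"
    using g by (simp add: measurable_cong_sets[OF sets_circle_borel refl])
  note m = measurable_comp_cis[OF g]
  have "integral\<^sup>L circle_borel g = integral\<^sup>L (uniform_measure lborel {-pi<..pi}) (\<lambda>x. g (cis x))"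
    unfolding circle_borel_def by (rule integral_distr[OF cis_measurable_sphere g'])
  also have "\<dots> = (1 / (2 * pi)) *\<^sub>R (LINT \<phi>|lborel. indicator {-pi<..pi} \<phi> *\<^sub>R g (cis \<phi>))"
  proof -
    have *: "uniform_measure lborel {-pi<..pi} = density lborel (\<lambda>x. ennreal (indicator {-pi<..pi} x / (2 * pi)))"
      unfolding uniform_measure_def
      by (rule arg_cong[where f="density lborel"]) 
         (auto simp: fun_eq_iff divide_ennreal split: split_indicator simp flip: ennreal_1)
    show ?thesis
      unfolding * using m
      by (subst integral_density, simp, simp, simp, subst integral_scaleR_right[symmetric])
        (rule Bochner_Integration.integral_cong, simp_all add: divide_simps)
  qed
  also have "(LINT \<phi>|lborel. indicator {-pi<..pi} \<phi> *\<^sub>R g (cis \<phi>)) = (LINT \<phi>|lborel. indicator {-pi..pi} \<phi> *\<^sub>R g (cis \<phi>))"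
  proof (rule integral_cong_AE)
    have "AE x in lborel. x \<noteq> - pi" by (rule AE_lborel_singleton)
    then show "AE x in lborel. indicator {-pi<..pi} x *\<^sub>R g (cis x) = indicator {-pi..pi} x *\<^sub>R g (cis x)"
      by eventually_elim (auto split: split_indicator)
  qed (rule borel_measurable_scaleR[OF borel_measurable_indicator m]; simp)+
  also have "\<dots> = (LINT \<phi>:{-pi..pi}|lebesgue. g (cis \<phi>))"
    unfolding set_lebesgue_integral_def
    by (intro integral_completion[symmetric] borel_measurable_scaleR borel_measurable_indicator m) simp
  finally show ?thesis
    by (simp add: scaleR_conv_of_real)
qed

text \<open>Null sets of an image measure pull back to null sets; the uniform measure sees only the
  angles in the half-open interval.\<close>

lemma AE_circle_borel_lebesgue:
  assumes "AE t in circle_borel. P t"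
  shows "AE \<phi> in lebesgue. \<phi> \<in> {-pi<..pi} \<longrightarrow> P (cis \<phi>)"
proof -
  have "AE x in uniform_measure lborel {-pi<..pi}. P (cis x)"
    using assms unfolding circle_borel_def
    by (rule AE_distrD[OF cis_measurable_sphere])
  then have "AE \<phi> in lborel. \<phi> \<in> {-pi<..pi} \<longrightarrow> P (cis \<phi>)"
    by (subst (asm) AE_uniform_measure) auto
  then show ?thesis by (rule AE_completion)
qed

lemma integral_circle_measure:
  fixes f :: "complex \<Rightarrow> complex"
  assumes f: "f \<in> borel_measurable circle_measure"
  shows "integral\<^sup>L circle_measure f = 1 / (2 * pi) * (LINT \<phi>:{-pi..pi}|lebesgue. f (cis \<phi>))"
proof -
  obtain g where g: "g \<in> borel_measurable circle_borel" and eq: "AE t in circle_borel. f t = g t"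
    using ex_circle_borel[OF f] .
  have g': "g \<in> borel_measurable circle_measure"
    by (rule borel_measurable_circle_measureI[OF g])
  have "integral\<^sup>L circle_measure f = integral\<^sup>L circle_measure g"
    using f g' AE_completion[OF eq, folded circle_measure_eq] by (intro integral_cong_AE)
  also have "\<dots> = integral\<^sup>L circle_borel g"
    unfolding circle_measure_eq by (rule integral_completion[OF g])
  also have "\<dots> = 1 / (2 * pi) * (LINT \<phi>:{-pi..pi}|lebesgue. g (cis \<phi>))"
    by (rule integral_circle_borel[OF g])
  also have "(LINT \<phi>:{-pi..pi}|lebesgue. g (cis \<phi>)) = (LINT \<phi>:{-pi..pi}|lebesgue. f (cis \<phi>))"
  proof -
    have "AE x in lborel. x \<noteq> - pi" by (rule AE_lborel_singleton)
    then have "AE x in lebesgue. x \<noteq> - pi" by (rule AE_completion)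
    with AE_circle_borel_lebesgue[OF eq]
    have ae: "AE x in lebesgue. indicator {-pi..pi} x *\<^sub>R g (cis x) = indicator {-pi..pi} x *\<^sub>R f (cis x)"
      by eventually_elim (auto split: split_indicator)
    have "(\<lambda>x. indicator {-pi..pi} x *\<^sub>R g (cis x)) \<in> borel_measurable lborel"
      by (intro borel_measurable_scaleR borel_measurable_indicator measurable_comp_cis[OF g]) simp
    then have 1: "(\<lambda>x. indicator {-pi..pi} x *\<^sub>R g (cis x)) \<in> borel_measurable lebesgue"
      by (rule measurable_completion)
    \<comment> \<open>The left factor of measurability is lost when f is not Borel; here it returns
      because \<open>lebesgue\<close> is complete and f agrees a.e. with g along
      \<open>cis\<close>.\<close>
    have 2: "(\<lambda>x. indicator {-pi..pi} x *\<^sub>R f (cis x)) \<in> borel_measurable lebesgue"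
      using borel_measurable_AE[OF 1 ae] .
    show ?thesis
      unfolding set_lebesgue_integral_def by (rule integral_cong_AE[OF 1 2 ae])
  qed
  finally show ?thesis .
qed

text \<open>On the circle conjugation is inversion, so \<open>cnj s powi n\<close> is the character
  of frequency -n written without the angle. From here on no computation with f refers to
  angles.\<close>

lemma fourier_coeff_eq:
  assumes f: "f \<in> borel_measurable circle_measure"
  shows "fourier_coeff f n = (LINT s|circle_measure. f s * cnj s powi n)"
proof -
  have m: "(\<lambda>s. cnj s powi n) \<in> borel_measurable circle_measure"
  proof -
    have [measurable]: "cnj \<in> borel_measurable borel"
      by (intro borel_measurable_continuous_onI continuous_intros)
    have "(\<lambda>s::complex. cnj s powi n) \<in> borel_measurable borel"
      by (cases "0 \<le> n") (simp_all add: power_int_def)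
    then show ?thesis
      by (rule borel_imp_circle_measure)
  qed
  have "exp (- \<i> * of_int n * of_real \<phi>) = cnj (cis \<phi>) powi n" for \<phi> :: real
    by (simp add: cis_cnj cis_power_int) (simp add: cis_conv_exp mult_ac)
  then show ?thesis
    using integral_circle_measure[of "\<lambda>s. f s * cnj s powi n"] f m by (simp add: fourier_coeff_def)
qed

text \<open>Orthogonality of characters: for nonzero n the antiderivative e^(inx)/(in) takes the
  same value at both ends of the period.\<close>

lemma integral_powi:
  "(LINT s|circle_measure. s powi n) = (if n = 0 then 1 else 0)"
proof (cases "n = 0")
  case True
  then show ?thesis using cm.prob_space by simp
next
  case False
  have "(\<lambda>s::complex. s powi n) \<in> borel_measurable borel"
    by (cases "0 \<le> n") (simp_all add: power_int_def)
  then have m: "(\<lambda>s. s powi n) \<in> borel_measurable circle_measure"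
    by (rule borel_imp_circle_measure)
  have "(LINT \<phi>:{-pi..pi}|lebesgue. cis \<phi> powi n) = (LINT \<phi>:{-pi..pi}|lborel. cis \<phi> powi n)"
    unfolding set_lebesgue_integral_def
    by (intro integral_completion) (simp add: cis_power_int, measurable)
  also have "\<dots> = (\<integral>\<phi>. indicator {-pi..pi} \<phi> *\<^sub>R cis (of_int n * \<phi>) \<partial>lborel)"
    by (simp add: set_lebesgue_integral_def cis_power_int)
  also have "\<dots> = cis (of_int n * pi) / (\<i> * of_int n) - cis (of_int n * (-pi)) / (\<i> * of_int n)"
  proof (rule integral_FTC_Icc)
    have aux: "- (\<i> * (z * \<i>)) = z" for z :: complex
      by (simp add: complex_eq_iff)
    show "((\<lambda>x. cis (of_int n * x) / (\<i> * of_int n)) has_vector_derivative cis (of_int n * x)) (at x within {- pi..pi})" for x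
    proof -
      have "((\<lambda>z. exp (\<i> * (of_int n * z)) / (\<i> * of_int n)) has_field_derivative exp (\<i> * (of_int n * of_real x))) (at (of_real x))"
        using False by (auto intro!: derivative_eq_intros simp: aux)
      from has_vector_derivative_real_field[OF this] show ?thesis
        by (simp add: cis_conv_exp mult.assoc)
    qed
    show "continuous_on {- pi..pi} (\<lambda>x. cis (of_int n * x))"
      by (intro continuous_intros)
  qed auto
  also have "\<dots> = 0"
    using sin_npi_int[of n] by (simp add: mult.commute complex_eq_iff Re_divide Im_divide)
  finally show ?thesis
    using integral_circle_measure[OF m] False by simp
qed

section \<open>The de la Vallee Poussin kernel\<close>

text \<open>The argument x stands for the cosine of the angle, which makes monotonicity a statement
  about a power of 1 + x. The central binomial coefficient is the constant Fourier coefficient of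
  the numerator.\<close>

definition vp_kernel :: "nat \<Rightarrow> real \<Rightarrow> real" where
  "vp_kernel n x = 2 ^ n * (1 + x) ^ n / real ((2 * n) choose n)"

text \<open>The Fourier multiplier of frequency j - n; the shift by n keeps the index a natural
  number in 0..2n.\<close>

definition vp_coeff :: "nat \<Rightarrow> nat \<Rightarrow> real" where
  "vp_coeff n j = real ((2 * n) choose j) / real ((2 * n) choose n)"

lemma sphere_mult_cnj: "cmod z = 1 \<Longrightarrow> z * cnj z = 1"
  by (simp flip: complex_norm_square)

lemma sphere_cnj_inverse: "cmod z = 1 \<Longrightarrow> cnj z = inverse z"
  using sphere_mult_cnj[of z] by (simp add: inverse_unique)

text \<open>On the circle 2(1 + Re z) = (1 + z)^2 / z, so its n-th power is (1 + z)^(2n) / z^n and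
  the binomial theorem yields the Fourier expansion.\<close>

lemma vp_kernel_expand:
  assumes "cmod z = 1"
  shows "complex_of_real (vp_kernel n (Re z)) = (\<Sum>j\<le>2*n. of_real (vp_coeff n j) * z ^ j * cnj z ^ n)"
proof -
  have zz: "z * cnj z = 1"
    using assms by (rule sphere_mult_cnj)
  have "(1 + z)^2 * cnj z = cnj z + 2 * (z * cnj z) + z * (z * cnj z)"
    by (simp add: power2_eq_square algebra_simps)
  also have "\<dots> = of_real (2 * (1 + Re z))"
    unfolding zz by (simp add: complex_eq_iff)
  finally have "of_real ((2 * (1 + Re z)) ^ n) = ((1 + z)^2 * cnj z) ^ n"
    by simp
  also have "\<dots> = (1 + z) ^ (2 * n) * cnj z ^ n"
    by (simp add: power_mult_distrib power_mult)
  also have "(1 + z) ^ (2 * n) = (\<Sum>j\<le>2*n. of_nat ((2 * n) choose j) * z ^ j)"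
    using binomial_ring[of z 1 "2*n"] by (simp add: add.commute)
  finally have *: "of_real ((2 * (1 + Re z)) ^ n) = (\<Sum>j\<le>2*n. of_nat ((2 * n) choose j) * z ^ j) * cnj z ^ n" .
  have "complex_of_real (vp_kernel n (Re z)) = of_real ((2 * (1 + Re z)) ^ n) / of_nat ((2 * n) choose n)"
    by (simp add: vp_kernel_def flip: power_mult_distrib)
  then show ?thesis
    unfolding * by (simp add: vp_coeff_def sum_distrib_right sum_divide_distrib)
qed

lemma vp_kernel_nonneg: "-1 \<le> x \<Longrightarrow> 0 \<le> vp_kernel n x"
  by (simp add: vp_kernel_def)

lemma vp_kernel_mono: "-1 \<le> x \<Longrightarrow> x \<le> y \<Longrightarrow> vp_kernel n x \<le> vp_kernel n y"
  unfolding vp_kernel_def by (intro divide_right_mono mult_left_mono power_mono) auto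

lemma continuous_on_vp_kernel [continuous_intros]:
  "continuous_on S f \<Longrightarrow> continuous_on S (\<lambda>x. vp_kernel n (f x))"
  unfolding vp_kernel_def by (intro continuous_intros) (auto simp: zero_less_binomial)

lemma vp_kernel_measurable [measurable]: "vp_kernel n \<in> borel_measurable borel"
  by (intro borel_measurable_continuous_onI continuous_intros)

section \<open>Convolution with the kernel and its Fourier multipliers\<close>

lemma Re_mult_cnj_commute: "Re (t * cnj s) = Re (s * cnj t)"
  by simp

lemma Re_sphere_bounds:
  assumes "cmod t = 1" "cmod s = 1"
  shows "-1 \<le> Re (t * cnj s)" "Re (t * cnj s) \<le> 1"
proof -
  have "\<bar>Re (t * cnj s)\<bar> \<le> cmod (t * cnj s)" by (rule abs_Re_le_cmod)
  also have "\<dots> = 1" using assms by (simp add: norm_mult)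
  finally show "-1 \<le> Re (t * cnj s)" "Re (t * cnj s) \<le> 1" by auto
qed

text \<open>For t and s on the circle \<open>Re (t * cnj s)\<close> is the cosine of the angle
  between them, so this is the convolution of f with V_n.\<close>

definition vp :: "nat \<Rightarrow> (complex \<Rightarrow> complex) \<Rightarrow> complex \<Rightarrow> complex" where
  "vp n f t = (LINT s|circle_measure. of_real (vp_kernel n (Re (t * cnj s))) * f s)"

lemma cnj_powi_sphere:
  assumes "cmod s = 1"
  shows "s ^ n * cnj s ^ j = cnj s powi (int j - int n)"
proof -
  have s: "s \<noteq> 0" "cnj s = inverse s"
    using assms by (auto simp: sphere_cnj_inverse)
  then show ?thesis
    unfolding s(2) by (simp add: power_int_diff divide_inverse power_inverse mult.commute)
qed

lemma borel_measurable_powi [measurable]: "(\<lambda>s::complex. s powi k) \<in> borel_measurable borel"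
  by (cases "0 \<le> k") (simp_all add: power_int_def)

lemma borel_measurable_cnj [measurable]: "cnj \<in> borel_measurable borel"
  by (intro borel_measurable_continuous_onI continuous_intros)

lemma integrable_mult_bounded_circle:
  fixes f h :: "complex \<Rightarrow> complex"
  assumes f: "integrable circle_measure f" and h: "h \<in> borel_measurable borel"
    and b: "\<And>s. cmod s = 1 \<Longrightarrow> cmod (h s) \<le> B"
  shows "integrable circle_measure (\<lambda>s. h s * f s)"
proof (rule Bochner_Integration.integrable_bound)
  show "integrable circle_measure (\<lambda>s. B *\<^sub>R f s)" using f by (intro integrable_scaleR_right)
  show "(\<lambda>s. h s * f s) \<in> borel_measurable circle_measure"
    using f borel_imp_circle_measure[OF h] by auto
  have "cmod (h s * f s) \<le> cmod (B *\<^sub>R f s)" if "cmod s = 1" for s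
    using b[OF that] by (auto simp: norm_mult intro!: mult_right_mono)
  then show "AE s in circle_measure. cmod (h s * f s) \<le> cmod (B *\<^sub>R f s)"
    by (intro AE_I2) simp
qed

text \<open>The kernel expansion at \<open>t * cnj s\<close> separates the variables: frequency k
  contributes t^k times the conjugate character in s, and integrating the latter against f is a
  Fourier coefficient.\<close>

lemma vp_eq_sum:
  assumes f: "integrable circle_measure f" and t: "cmod t = 1"
  shows "vp n f t = (\<Sum>j\<le>2*n. of_real (vp_coeff n j) * fourier_coeff f (int j - int n) * t powi (int j - int n))"
proof -
  have "vp n f t = (LINT s|circle_measure. (\<Sum>j\<le>2*n. (of_real (vp_coeff n j) * t powi (int j - int n)) * (cnj s powi (int j - int n) * f s)))"
    unfolding vp_def
  proof (rule Bochner_Integration.integral_cong, simp)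
    fix s assume "s \<in> space circle_measure"
    then have s: "cmod s = 1" by simp
    have *: "t ^ j * cnj t ^ n = t powi (int j - int n)" for j
      using cnj_powi_sphere[of "cnj t" j n] t
      by (metis complex_cnj_cnj complex_mod_cnj cnj_powi_sphere mult.commute)
    have **: "(t * cnj s) ^ j * cnj (t * cnj s) ^ n = t powi (int j - int n) * cnj s powi (int j - int n)" for j
    proof -
      have "(t * cnj s) ^ j * cnj (t * cnj s) ^ n = (t ^ j * cnj t ^ n) * (s ^ n * cnj s ^ j)"
        by (simp add: power_mult_distrib)
      then show ?thesis
        using * cnj_powi_sphere[OF s, of n j] by simp
    qed
    have "cmod (t * cnj s) = 1" using s t by (simp add: norm_mult)
    from vp_kernel_expand[OF this, of n]
    show "of_real (vp_kernel n (Re (t * cnj s))) * f s =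
        (\<Sum>j\<le>2*n. (of_real (vp_coeff n j) * t powi (int j - int n)) * (cnj s powi (int j - int n) * f s))"
      by (simp only: ** mult.assoc sum_distrib_right)
  qed
  also have "\<dots> = (\<Sum>j\<le>2*n. (of_real (vp_coeff n j) * t powi (int j - int n)) * fourier_coeff f (int j - int n))"
  proof (subst Bochner_Integration.integral_sum)
    fix j
    show "integrable circle_measure (\<lambda>s. (of_real (vp_coeff n j) * t powi (int j - int n)) * (cnj s powi (int j - int n) * f s))"
      by (intro integrable_mult_right integrable_mult_bounded_circle[OF f, where B=1]) (auto simp: norm_power_int)
  qed (use f in \<open>simp add: fourier_coeff_eq mult.commute\<close>)
  finally show ?thesis by (simp add: mult_ac)
qed

lemma fourier_coeff_powi:
  "fourier_coeff (\<lambda>s. s powi k) m = (if k = m then 1 else 0)"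
proof -
  have m: "(\<lambda>s. s powi k) \<in> borel_measurable circle_measure"
    by (rule borel_imp_circle_measure) measurable
  have "fourier_coeff (\<lambda>s. s powi k) m = (LINT s|circle_measure. s powi (k - m))"
    unfolding fourier_coeff_eq[OF m]
  proof (rule Bochner_Integration.integral_cong, simp)
    fix s :: complex assume "s \<in> space circle_measure"
    then have "cmod s = 1" by simp
    then have s: "s \<noteq> 0" "cnj s = inverse s"
      by (auto simp: sphere_cnj_inverse)
    then show "s powi k * cnj s powi m = s powi (k - m)"
      unfolding s(2) by (simp add: power_int_diff power_int_inverse divide_inverse)
  qed
  then show ?thesis by (simp add: integral_powi)
qed

lemma integrable_powi_circle: "integrable circle_measure (\<lambda>s. s powi k)"
proof (rule cm.integrable_const_bound[where B=1])
  show "AE s in circle_measure. cmod (s powi k) \<le> 1"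
    by (intro AE_I2) (simp add: norm_power_int)
  show "(\<lambda>s. s powi k) \<in> borel_measurable circle_measure"
    by (rule borel_imp_circle_measure) measurable
qed

text \<open>The bound on k places the index n + k inside 0..2n, so exactly one term of the
  multiplier sum survives.\<close>

lemma vp_powi:
  assumes t: "cmod t = 1" and k: "nat \<bar>k\<bar> \<le> n"
  shows "vp n (\<lambda>s. s powi k) t = of_real (vp_coeff n (nat (int n + k))) * t powi k"
proof -
  have eq: "k = int j - int n \<longleftrightarrow> j = nat (int n + k)" for j
    using k by auto
  have "vp n (\<lambda>s. s powi k) t = (\<Sum>j\<le>2*n. if j = nat (int n + k) then of_real (vp_coeff n j) * t powi (int j - int n) else 0)"
    unfolding vp_eq_sum[OF integrable_powi_circle t] fourier_coeff_powi eq
    by (intro sum.cong) auto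
  also have "\<dots> = of_real (vp_coeff n (nat (int n + k))) * t powi k"
    using k by (subst sum.delta) auto
  finally show ?thesis .
qed

text \<open>Consecutive coefficients have ratio (n - k) / (n + k + 1), which tends to 1; for n \<ge>
  k the natural subtraction in the binomial identity is exact.\<close>

lemma tendsto_vp_coeff_nat: "(\<lambda>n. vp_coeff n (n + k)) \<longlonglongrightarrow> 1"
proof (induction k)
  case 0
  have "vp_coeff n (n + 0) = 1" for n
    by (simp add: vp_coeff_def)
  then show ?case by simp
next
  case (Suc k)
  have "eventually (\<lambda>n. vp_coeff n (n + k) * ((real n - real k) / (real n + real k + 1)) = vp_coeff n (n + Suc k)) sequentially"
    using eventually_ge_at_top[of k]
  proof eventually_elim
    case (elim n)
    have "Suc (n + k) * ((2 * n) choose Suc (n + k)) = (2 * n - (n + k)) * ((2 * n) choose (n + k))"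
      by (metis binomial_absorb_comp binomial_absorption mult.commute)
    then have "real (Suc (n + k)) * real ((2 * n) choose Suc (n + k)) = real (2 * n - (n + k)) * real ((2 * n) choose (n + k))"
      by (metis of_nat_mult)
    moreover have "real (2 * n - (n + k)) = real n - real k" using elim by (simp add: of_nat_diff)
    ultimately have "real ((2 * n) choose Suc (n + k)) = (real n - real k) * real ((2 * n) choose (n + k)) / (real n + real k + 1)"
      by (simp add: field_simps)
    then show ?case by (simp add: vp_coeff_def mult_ac)
  qed
  moreover have "(\<lambda>n. vp_coeff n (n + k) * ((real n - real k) / (real n + real k + 1))) \<longlonglongrightarrow> 1 * 1"
  proof (intro tendsto_mult Suc.IH)
    show "(\<lambda>n. (real n - real k) / (real n + real k + 1)) \<longlonglongrightarrow> 1" by real_asymp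
  qed
  ultimately show ?case using Lim_transform_eventually by fastforce
qed

text \<open>Negative frequencies reduce to positive ones by the symmetry of binomial coefficients,
  once n is so large that \<open>nat\<close> no longer truncates n + k.\<close>

lemma tendsto_vp_coeff: "(\<lambda>n. vp_coeff n (nat (int n + k))) \<longlonglongrightarrow> 1"
proof (cases "0 \<le> k")
  case True
  then show ?thesis using tendsto_vp_coeff_nat[of "nat k"] by (simp add: nat_add_distrib)
next
  case False
  have "eventually (\<lambda>n. vp_coeff n (n + nat (-k)) = vp_coeff n (nat (int n + k))) sequentially"
    using eventually_ge_at_top[of "nat (-k)"]
  proof eventually_elim
    case (elim n)
    have "(2 * n) choose (n + nat (-k)) = (2 * n) choose (2 * n - (n + nat (-k)))"
      using elim by (intro binomial_symmetric) auto
    also have "2 * n - (n + nat (-k)) = nat (int n + k)" using elim False by auto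
    finally show ?case by (simp add: vp_coeff_def)
  qed
  from Lim_transform_eventually[OF tendsto_vp_coeff_nat this] show ?thesis .
qed

text \<open>The mean of the kernel is the convolution with the constant function
  \<open>s powi 0\<close>, hence the multiplier of frequency 0, which is 1.\<close>

lemma vp_kernel_integral:
  assumes t: "cmod t = 1"
  shows "(\<integral>\<^sup>+s. ennreal (vp_kernel n (Re (t * cnj s))) \<partial>circle_measure) = 1"
proof -
  have m: "(\<lambda>s. vp_kernel n (Re (t * cnj s))) \<in> borel_measurable circle_measure"
    by (rule borel_imp_circle_measure) measurable
  have nn: "AE s in circle_measure. 0 \<le> vp_kernel n (Re (t * cnj s))"
    using Re_sphere_bounds[OF t] by (intro AE_I2 vp_kernel_nonneg) auto
  have int: "integrable circle_measure (\<lambda>s. vp_kernel n (Re (t * cnj s)))"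
  proof (rule cm.integrable_const_bound)
    show "AE s in circle_measure. norm (vp_kernel n (Re (t * cnj s))) \<le> vp_kernel n 1"
    proof (rule AE_I2)
      fix s assume "s \<in> space circle_measure"
      then have s: "cmod s = 1" by simp
      show "norm (vp_kernel n (Re (t * cnj s))) \<le> vp_kernel n 1"
        using vp_kernel_nonneg[OF Re_sphere_bounds(1)[OF t s]] vp_kernel_mono[OF Re_sphere_bounds[OF t s]]
        by simp
    qed
  qed (rule m)
  have "complex_of_real (LINT s|circle_measure. vp_kernel n (Re (t * cnj s))) = vp n (\<lambda>s. s powi 0) t"
    by (simp add: vp_def flip: integral_of_real)
  also have "\<dots> = of_real 1"
    using vp_powi[OF t, of 0 n] by (simp add: vp_coeff_def)
  finally have "(LINT s|circle_measure. vp_kernel n (Re (t * cnj s))) = 1"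
    unfolding of_real_eq_iff .
  then show ?thesis
    using nn_integral_eq_integral[OF int nn] by simp
qed

section \<open>Superlevel arcs and domination by the maximal function\<close>

text \<open>Measured from s, the kernel is an increasing function of the cosine, which is even and
  decreases on [0, pi]. Hence an angle in the superlevel set brings along every angle of smaller
  absolute value, and the set is an interval around 0.\<close>

lemma vp_superlevel_arc:
  assumes s: "cmod s = 1" and ne: "\<exists>t. cmod t = 1 \<and> u < vp_kernel n (Re (t * cnj s))"
  shows "{t. cmod t = 1 \<and> u < vp_kernel n (Re (t * cnj s))} \<in> circle_arcs" (is "?I \<in> _")
    and "s \<in> {t. cmod t = 1 \<and> u < vp_kernel n (Re (t * cnj s))}"
proof -
  have ss: "s * cnj s = 1"
    using s by (rule sphere_mult_cnj)
  obtain t where t: "cmod t = 1" "u < vp_kernel n (Re (t * cnj s))" using ne by auto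
  have u1: "u < vp_kernel n 1"
    using t vp_kernel_mono[OF Re_sphere_bounds[OF t(1) s]] by (meson less_le_trans)
  then show "s \<in> ?I" using s by (simp only: mem_Collect_eq ss one_complex.sel)
  define a where "a = Arg s"
  have a: "s = cis a" unfolding a_def using rcis_cmod_Arg[of s] s by (simp add: rcis_def)
  define J0 where "J0 = {\<theta>\<in>{-pi..pi}. u < vp_kernel n (cos \<theta>)}"
  define J where "J = (\<lambda>\<theta>. a + \<theta>) ` J0"
  have abs: "cos \<bar>x\<bar> = cos x" for x :: real by (simp add: abs_if)
  have up: "\<theta> \<in> J0" if "\<bar>\<theta>\<bar> \<le> \<bar>\<eta>\<bar>" "\<eta> \<in> J0" for \<theta> \<eta>
  proof -
    have "cos \<bar>\<eta>\<bar> \<le> cos \<bar>\<theta>\<bar>"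
      using that by (intro cos_monotone_0_pi_le) (auto simp: J0_def)
    then have "cos \<eta> \<le> cos \<theta>" by (simp add: abs)
    then have "vp_kernel n (cos \<eta>) \<le> vp_kernel n (cos \<theta>)" by (intro vp_kernel_mono) auto
    then show ?thesis using that by (auto simp: J0_def)
  qed
  have "is_interval J0"
    unfolding is_interval_1
  proof (intro ballI allI impI)
    fix x y z assume "x \<in> J0" "y \<in> J0" "x \<le> z \<and> z \<le> y"
    then show "z \<in> J0" using up[of z x] up[of z y] by (cases "\<bar>x\<bar> \<le> \<bar>y\<bar>") auto
  qed
  then have 1: "is_interval J" unfolding J_def by simp
  \<comment> \<open>The inequality is strict, so the angles near 0, where the kernel is maximal, all
    belong to \<open>J0\<close>: the arc is nondegenerate, as \<open>circle_arcs\<close>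
    demands.\<close>
  have "open {\<theta>. u < vp_kernel n (cos \<theta>)}"
    by (intro open_Collect_less continuous_intros)
  then have "open ({\<theta>. u < vp_kernel n (cos \<theta>)} \<inter> {-pi<..<pi})" by auto
  moreover have "{\<theta>. u < vp_kernel n (cos \<theta>)} \<inter> {-pi<..<pi} \<subseteq> J0" by (auto simp: J0_def)
  moreover have "0 \<in> {\<theta>. u < vp_kernel n (cos \<theta>)} \<inter> {-pi<..<pi}" using u1 by simp
  ultimately have "interior J0 \<noteq> {}" by (metis empty_iff interior_maximal subsetD)
  then have 2: "interior J \<noteq> {}" unfolding J_def by (simp add: interior_translation)
  have "?I = cis ` J"
  proof (intro equalityI subsetI)
    fix x assume x: "x \<in> ?I"
    define b where "b = Arg (x * cnj s)"
    have "cmod (x * cnj s) = 1" using x s by (simp add: norm_mult)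
    then have b: "x * cnj s = cis b" unfolding b_def using rcis_cmod_Arg[of "x * cnj s"] by (simp add: rcis_def)
    have "x = x * cnj s * s" using ss by (simp add: mult.assoc mult.commute)
    also have "\<dots> = cis (a + b)" using b a by (simp add: cis_mult add.commute)
    finally have xx: "x = cis (a + b)" .
    have "u < vp_kernel n (cos b)" using x by (simp only: mem_Collect_eq b cis.sel)
    then have "b \<in> J0" using Arg_bounded[of "x * cnj s"] unfolding J0_def b_def[symmetric] by auto
    with xx show "x \<in> cis ` J" unfolding J_def by auto
  next
    fix x assume "x \<in> cis ` J"
    then obtain b where b: "b \<in> J0" "x = cis (a + b)" unfolding J_def by auto
    have e: "x * cnj s = cis b" using b a by (simp add: cis_cnj cis_mult)
    have "u < vp_kernel n (Re (x * cnj s))" using b(1) unfolding e by (simp add: J0_def)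
    then show "x \<in> ?I" using b(2) by (auto simp del: times_complex.sel)
  qed
  with 1 2 show "?I \<in> circle_arcs" unfolding circle_arcs_def by blast
qed

text \<open>The layer-cake formula writes the kernel as a superposition of arcs centred at \<open>s\<close>.\<close>

lemma nn_integral_vp_kernel_le_hl_maximal:
  assumes g: "g \<in> borel_measurable circle_measure" and s: "cmod s = 1"
  shows "(\<integral>\<^sup>+t. ennreal (vp_kernel n (Re (t * cnj s))) * ennreal (cmod (g t)) \<partial>circle_measure) \<le> hl_maximal g s"
proof -
  interpret pair_sigma_finite lborel circle_measure ..
  define K where "K t = vp_kernel n (Re (t * cnj s))" for t
  define A where "A u = {t. cmod t = 1 \<and> u < K t}" for u
  have K[measurable]: "K \<in> borel_measurable circle_measure"
    unfolding K_def by (rule borel_imp_circle_measure) measurable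
  note g[measurable]
  have K0: "0 \<le> K t" if "t \<in> space circle_measure" for t
    using that Re_sphere_bounds(1)[OF _ s, of t] unfolding K_def by (simp add: vp_kernel_nonneg)
  have layer: "ennreal (K t) = (\<integral>\<^sup>+u. indicator {0..<K t} u \<partial>lborel)" if "t \<in> space circle_measure" for t
    using K0[OF that] by simp
  have A[measurable]: "A u \<in> sets circle_measure" for u
  proof -
    have "A u = {t \<in> space circle_measure. u < K t}" by (auto simp: A_def)
    moreover have "{t \<in> space circle_measure. u < K t} \<in> sets circle_measure" by measurable
    ultimately show ?thesis by (simp only:)
  qed
  have ind: "indicator {0..<K t} u = (indicator {0..} u * indicator (A u) t :: ennreal)" if "t \<in> space circle_measure" for t u
    using that by (auto simp: A_def split: split_indicator)
  have mg: "(\<lambda>(u,t). ennreal (cmod (g t)) * indicator {0..<K t} u) \<in> borel_measurable (lborel \<Otimes>\<^sub>M circle_measure)"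
    unfolding indicator_def atLeastLessThan_iff by measurable
  have m1: "(\<lambda>(u,t). indicator {0..<K t} u :: ennreal) \<in> borel_measurable (lborel \<Otimes>\<^sub>M circle_measure)"
    unfolding indicator_def atLeastLessThan_iff by measurable
  \<comment> \<open>\<open>A u\<close> is an arc containing s, so the average of g over it is one of
    the quantities whose supremum is \<open>hl_maximal g s\<close>. Passing from the average to the
    integral needs positive measure, and null or empty sets are handled apart.\<close>
  have M: "(\<integral>\<^sup>+t. ennreal (cmod (g t)) * indicator (A u) t \<partial>circle_measure) \<le> hl_maximal g s * emeasure circle_measure (A u)" for u
  proof (cases "A u = {}")
    case True
    then show ?thesis by simp
  next
    case False
    then have ne: "\<exists>t. cmod t = 1 \<and> u < vp_kernel n (Re (t * cnj s))" by (auto simp: A_def K_def)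
    note arc = vp_superlevel_arc[OF s ne, folded K_def, folded A_def]
    let ?x = "\<integral>\<^sup>+t. ennreal (cmod (g t)) * indicator (A u) t \<partial>circle_measure"
    let ?m = "emeasure circle_measure (A u)"
    show ?thesis
    proof (cases "?m = 0")
      case True
      then have "?x = 0" using A by (simp add: nn_integral_null_set null_setsI)
      then show ?thesis by simp
    next
      case False
      have fin: "?m \<noteq> \<infinity>" by simp
      have "?x = ?x / ?m * ?m" using False fin by (simp add: ennreal_divide_times ennreal_divide_self less_top[symmetric])
      also have "\<dots> \<le> hl_maximal g s * ?m"
        unfolding hl_maximal_def using arc by (intro mult_right_mono SUP_upper) auto
      finally show ?thesis .
    qed
  qed
  have "(\<integral>\<^sup>+t. ennreal (K t) * ennreal (cmod (g t)) \<partial>circle_measure)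
      = (\<integral>\<^sup>+t. (\<integral>\<^sup>+u. ennreal (cmod (g t)) * indicator {0..<K t} u \<partial>lborel) \<partial>circle_measure)"
    by (intro nn_integral_cong) (simp add: layer nn_integral_cmult mult.commute)
  also have "\<dots> = (\<integral>\<^sup>+u. (\<integral>\<^sup>+t. ennreal (cmod (g t)) * indicator {0..<K t} u \<partial>circle_measure) \<partial>lborel)"
    using Fubini'[OF mg] by simp
  also have "\<dots> = (\<integral>\<^sup>+u. indicator {0..} u * (\<integral>\<^sup>+t. ennreal (cmod (g t)) * indicator (A u) t \<partial>circle_measure) \<partial>lborel)"
    by (intro nn_integral_cong, subst nn_integral_cmult[symmetric])
       (auto intro!: nn_integral_cong simp: ind mult_ac simp del: space_circle_measure)
  also have "\<dots> \<le> (\<integral>\<^sup>+u. indicator {0..} u * (hl_maximal g s * emeasure circle_measure (A u)) \<partial>lborel)"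
    by (intro nn_integral_mono mult_left_mono M) auto
  also have "\<dots> = (\<integral>\<^sup>+u. hl_maximal g s * (\<integral>\<^sup>+t. indicator {0..<K t} u \<partial>circle_measure) \<partial>lborel)"
  proof (intro nn_integral_cong)
    fix u :: real
    have "(\<integral>\<^sup>+t. indicator {0..<K t} u \<partial>circle_measure) = (\<integral>\<^sup>+t. indicator {0..} u * indicator (A u) t \<partial>circle_measure)"
      by (intro nn_integral_cong) (rule ind)
    also have "\<dots> = indicator {0..} u * emeasure circle_measure (A u)"
      by (simp add: nn_integral_cmult)
    finally show "indicator {0..} u * (hl_maximal g s * emeasure circle_measure (A u)) =
        hl_maximal g s * (\<integral>\<^sup>+t. indicator {0..<K t} u \<partial>circle_measure)"
      by (simp add: mult_ac)
  qed
  \<comment> \<open>The maximal function does not depend on the level u. Once it is pulled out, the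
    layer-cake formula is undone without g, which leaves the total mass 1 of the kernel.\<close>
  also have "\<dots> = hl_maximal g s * (\<integral>\<^sup>+u. (\<integral>\<^sup>+t. indicator {0..<K t} u \<partial>circle_measure) \<partial>lborel)"
    using cm.borel_measurable_nn_integral[OF m1] by (intro nn_integral_cmult) simp
  also have "(\<integral>\<^sup>+u. (\<integral>\<^sup>+t. indicator {0..<K t} u \<partial>circle_measure) \<partial>lborel) = (\<integral>\<^sup>+t. (\<integral>\<^sup>+u. indicator {0..<K t} u \<partial>lborel) \<partial>circle_measure)"
    using Fubini'[OF m1] by simp
  also have "\<dots> = (\<integral>\<^sup>+t. ennreal (K t) \<partial>circle_measure)"
    by (intro nn_integral_cong) (simp only: layer)
  also have "\<dots> = 1"
    using vp_kernel_integral[OF s, of n] unfolding K_def by (simp only: Re_mult_cnj_commute)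
  finally show ?thesis by (simp add: K_def)
qed

section \<open>Duality for Banach function norms\<close>

lemma tendsto_min_of_nat_ennreal: "(\<lambda>k. min x (of_nat k)) \<longlonglongrightarrow> (x::ennreal)"
  using tendsto_min[OF tendsto_const[of x] of_nat_tendsto_top_ennreal] by (simp add: min_def)

lemma integrable_bounded_circle:
  fixes f :: "complex \<Rightarrow> real"
  assumes "f \<in> borel_measurable circle_measure" "\<And>t. \<bar>f t\<bar> \<le> B"
  shows "integrable circle_measure f"
  using assms by (intro cm.integrable_const_bound[where B=B]) auto

text \<open>Integrating 2e|x| \<le> x^2 + e^2 over a probability space turns closeness in L2 into
  closeness in L1, from which an a.e. convergent subsequence can be extracted.\<close>

lemma integral_abs_less:
  fixes x :: "complex \<Rightarrow> real"
  assumes m: "x \<in> borel_measurable circle_measure" and b: "\<And>t. \<bar>x t\<bar> \<le> B" and e: "0 < e"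
    and lt: "(LINT t|circle_measure. (x t)^2) < e^2"
  shows "(LINT t|circle_measure. \<bar>x t\<bar>) < e"
proof -
  have B: "(x t)^2 \<le> B^2" for t
    using b[of t] by (metis abs_ge_zero power2_abs power_mono)
  have i1: "integrable circle_measure (\<lambda>t. (x t)^2)"
    using m B by (intro integrable_bounded_circle[where B="B^2"]) auto
  have i2: "integrable circle_measure (\<lambda>t. \<bar>x t\<bar>)"
    using m b by (intro integrable_bounded_circle[where B=B]) auto
  have "2 * e * \<bar>x t\<bar> \<le> (x t)^2 + e^2" for t
    using zero_le_power2[of "\<bar>x t\<bar> - e"] by (simp add: power2_diff mult_ac)
  then have "(LINT t|circle_measure. 2 * e * \<bar>x t\<bar>) \<le> (LINT t|circle_measure. (x t)^2 + e^2)"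
    using i1 i2 by (intro integral_mono) auto
  also have "\<dots> = (LINT t|circle_measure. (x t)^2) + e^2"
    using i1 cm.prob_space by simp
  also have "\<dots> < 2 * e * e" using lt by (simp add: power2_eq_square)
  finally show ?thesis using e by simp
qed

section \<open>Fatou's lemma for the norm and the second associate norm of bounded functions\<close>

context banach_function_norm
begin

lemma rho_cong_AE:
  assumes "f \<in> L0_plus" "g \<in> L0_plus" "AE t in circle_measure. f t = g t"
  shows "\<rho> f = \<rho> g"
proof (rule antisym)
  show "\<rho> f \<le> \<rho> g" using assms(3) by (intro lattice assms) (auto elim: eventually_mono)
  show "\<rho> g \<le> \<rho> f" using assms(3) by (intro lattice assms) (auto elim: eventually_mono)
qed

lemma rho_mono:
  assumes "f \<in> L0_plus" "g \<in> L0_plus" "\<And>t. cmod t = 1 \<Longrightarrow> f t \<le> g t"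
  shows "\<rho> f \<le> \<rho> g"
  using assms by (intro lattice AE_I2) auto

lemma rho_one_finite: "\<rho> (\<lambda>_. 1) < \<infinity>"
proof -
  have s: "space circle_measure \<in> sets circle_measure" by (rule sets.top)
  have "\<rho> (indicator (space circle_measure)) < \<infinity>"
    using cm.emeasure_space_1 by (intro finite_indicator s) simp
  moreover have "\<rho> (\<lambda>_. 1) \<le> \<rho> (indicator (space circle_measure))"
    using s by (intro rho_mono) (auto simp: L0_plus_def)
  ultimately show ?thesis by (rule le_less_trans[rotated])
qed

lemma rho_bounded:
  assumes "f \<in> L0_plus" "AE t in circle_measure. f t \<le> ennreal B" "0 \<le> B"
  shows "\<rho> f \<le> ennreal B * \<rho> (\<lambda>_. 1)"
proof -
  have "\<rho> f \<le> \<rho> (\<lambda>t. ennreal B * 1)"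
    using assms by (intro lattice) (auto simp: L0_plus_def)
  also have "\<dots> = ennreal B * \<rho> (\<lambda>_. 1)"
    using assms by (intro homogeneous) (auto simp: L0_plus_def)
  finally show ?thesis .
qed

text \<open>Tail infima increase to the limit and lie below the original functions, so the monotone
  Fatou axiom gives the Fatou lemma: balls are closed under a.e. convergence.\<close>

lemma rho_le_of_tendsto:
  assumes F: "\<And>n. F n \<in> L0_plus" and f: "f \<in> L0_plus"
    and lim: "AE t in circle_measure. (\<lambda>n. F n t) \<longlonglongrightarrow> f t"
    and c: "\<And>n::nat. \<rho> (F n) \<le> c"
  shows "\<rho> f \<le> c"
proof -
  define G where "G n t = (INF k\<in>{n..}. F k t)" for n t
  have F': "F n \<in> borel_measurable circle_measure" for n
    using F by (simp add: L0_plus_def)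
  have G: "G n \<in> L0_plus" for n
    unfolding G_def L0_plus_def using F' by (intro borel_measurable_INF) auto
  have "incseq (\<lambda>n. \<rho> (G n)) \<and> (\<lambda>n. \<rho> (G n)) \<longlonglongrightarrow> \<rho> f"
  proof (rule fatou[OF G f])
    show "AE t in circle_measure. incseq (\<lambda>n. G n t) \<and> (\<lambda>n. G n t) \<longlonglongrightarrow> f t"
      using lim
    proof eventually_elim
      case (elim t)
      have inc: "incseq (\<lambda>n. G n t)"
        unfolding G_def by (intro monoI INF_superset_mono) auto
      have "f t = liminf (\<lambda>n. F n t)"
        using lim_imp_Liminf[OF _ elim] by simp
      also have "\<dots> = (SUP n. G n t)"
        by (simp add: liminf_SUP_INF G_def)
      finally show ?case using inc LIMSEQ_SUP[OF inc] by simp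
    qed
  qed
  moreover have "\<rho> (G n) \<le> c" for n
  proof -
    have "\<rho> (G n) \<le> \<rho> (F n)"
      by (intro rho_mono G F) (auto simp: G_def intro: INF_lower)
    with c[of n] show ?thesis by (rule order_trans[rotated])
  qed
  ultimately show ?thesis
    using LIMSEQ_le_const2 by blast
qed

lemma rho_convex:
  fixes x y :: "complex \<Rightarrow> real"
  assumes m: "x \<in> borel_measurable circle_measure" "y \<in> borel_measurable circle_measure"
    and nn: "\<And>t. 0 \<le> x t" "\<And>t. 0 \<le> y t"
    and r: "\<rho> (\<lambda>t. ennreal (x t)) \<le> 1" "\<rho> (\<lambda>t. ennreal (y t)) \<le> 1"
    and e: "0 \<le> e" "e \<le> 1"
  shows "\<rho> (\<lambda>t. ennreal ((1 - e) * x t + e * y t)) \<le> 1"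
proof -
  have "\<rho> (\<lambda>t. ennreal ((1 - e) * x t + e * y t)) = \<rho> (\<lambda>t. ennreal (1 - e) * ennreal (x t) + ennreal e * ennreal (y t))"
    using nn e by (simp add: ennreal_mult ennreal_plus)
  also have "\<dots> \<le> \<rho> (\<lambda>t. ennreal (1 - e) * ennreal (x t)) + \<rho> (\<lambda>t. ennreal e * ennreal (y t))"
    using m by (intro triangle) (auto simp: L0_plus_def)
  also have "\<dots> = ennreal (1 - e) * \<rho> (\<lambda>t. ennreal (x t)) + ennreal e * \<rho> (\<lambda>t. ennreal (y t))"
    using m e by (subst (1 2) homogeneous) (auto simp: L0_plus_def)
  also have "\<dots> \<le> ennreal (1 - e) * 1 + ennreal e * 1"
    by (intro add_mono mult_left_mono r) auto
  also have "\<dots> = 1"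
    using e by (simp flip: ennreal_plus)
  finally show ?thesis .
qed

text \<open>
  The unit ball of \<open>\<rho>\<close> below \<open>f\<close> is convex and, by the Fatou property, closed in \<open>L\<^sup>2\<close>.
  Its point nearest to \<open>f\<close> exists because a minimizing sequence is Cauchy by the parallelogram law.
\<close>

lemma nearest_point_exists:
  fixes f :: "complex \<Rightarrow> real"
  assumes f: "f \<in> borel_measurable circle_measure" and fB: "\<And>t. 0 \<le> f t" "\<And>t. f t \<le> B"
  defines "S \<equiv> {s \<in> borel_measurable circle_measure. (\<forall>t. 0 \<le> s t \<and> s t \<le> f t) \<and> \<rho> (\<lambda>t. ennreal (s t)) \<le> 1}"
  obtains h where "h \<in> S" "\<And>s. s \<in> S \<Longrightarrow> (LINT t|circle_measure. (f t - h t)^2) \<le> (LINT t|circle_measure. (f t - s t)^2)"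
proof -
  define d where "d s = (LINT t|circle_measure. (f t - s t)^2)" for s
  define D where "D = Inf (d ` S)"
  have SD: "s \<in> borel_measurable circle_measure" "0 \<le> s t" "s t \<le> f t" "\<rho> (\<lambda>t. ennreal (s t)) \<le> 1" if "s \<in> S" for s t
    using that by (auto simp: S_def)
  have sq: "\<bar>(a - b)^2\<bar> \<le> B^2" if "0 \<le> a" "a \<le> B" "0 \<le> b" "b \<le> B" for a b :: real
  proof -
    have "\<bar>a - b\<bar> \<le> B" using that by auto
    then show ?thesis by (metis abs_ge_zero abs_power2 power2_abs power_mono)
  qed
  \<comment> \<open>Because members of \<open>S\<close> lie below the bounded f, all squares in
    sight are bounded and integrable; unbounded elements of the ball never enter.\<close>
  have S_le: "s t \<le> B" if "s \<in> S" for s t using SD(3)[OF that, of t] fB(2)[of t] by simp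
  have int: "integrable circle_measure (\<lambda>t. (f t - s t)^2)" if "s \<in> S" for s
    using SD[OF that] f fB S_le[OF that] by (intro integrable_bounded_circle[where B="B^2"] sq) auto
  have int2: "integrable circle_measure (\<lambda>t. (s t - s' t)^2)" if "s \<in> S" "s' \<in> S" for s s'
    using SD[OF that(1)] SD[OF that(2)] S_le that by (intro integrable_bounded_circle[where B="B^2"] sq) auto
  have "\<rho> (\<lambda>t. 0) = 0"
    by (subst zero_iff) (auto simp: L0_plus_def)
  then have "(\<lambda>_. 0) \<in> S" using fB by (auto simp: S_def)
  then have ne: "d ` S \<noteq> {}" by auto
  have bdd: "bdd_below (d ` S)"
    by (intro bdd_belowI[of _ 0]) (auto simp: d_def)
  have D_le: "D \<le> d s" if "s \<in> S" for s
    unfolding D_def using bdd that by (intro cInf_lower) auto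
  have "\<exists>s\<in>S. d s < D + inverse (real (Suc n))" for n
  proof -
    have "Inf (d ` S) < D + inverse (real (Suc n))" by (simp add: D_def)
    then show ?thesis using cInf_lessD[OF ne] by blast
  qed
  then obtain s where s: "\<And>n. s n \<in> S" "\<And>n. d (s n) < D + inverse (real (Suc n))" by metis
  have mid: "(\<lambda>t. (s i t + s j t) / 2) \<in> S" for i j
  proof -
    have "\<rho> (\<lambda>t. ennreal ((1 - 1/2) * s i t + 1/2 * s j t)) \<le> 1"
      using SD[OF s(1)] by (intro rho_convex) auto
    then have "\<rho> (\<lambda>t. ennreal ((s i t + s j t) / 2)) \<le> 1" by (simp add: add_divide_distrib)
    moreover have "(s i t + s j t) / 2 \<le> f t" for t
      using SD(3)[OF s(1)[of i], of t] SD(3)[OF s(1)[of j], of t] by simp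
    ultimately show ?thesis
      using SD(1,2)[OF s(1)] by (auto simp: S_def intro!: add_nonneg_nonneg borel_measurable_divide borel_measurable_add)
  qed
  \<comment> \<open>In the parallelogram identity the midpoint contributes at least D with weight 4,
    which cancels the two copies of 2D coming from the minimizing sequence.\<close>
  have par: "(LINT t|circle_measure. (s i t - s j t)^2) \<le> 2 * inverse (real (Suc i)) + 2 * inverse (real (Suc j))" for i j
  proof -
    have "(LINT t|circle_measure. (s i t - s j t)^2) =
       (LINT t|circle_measure. 2 * (f t - s i t)^2 + 2 * (f t - s j t)^2 - 4 * (f t - (s i t + s j t) / 2)^2)"
      by (intro Bochner_Integration.integral_cong) (auto simp: power2_eq_square field_simps)
    also have "\<dots> = 2 * d (s i) + 2 * d (s j) - 4 * d (\<lambda>t. (s i t + s j t) / 2)"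
      using int[OF s(1)] int[OF mid] by (simp add: d_def)
    also have "\<dots> \<le> 2 * inverse (real (Suc i)) + 2 * inverse (real (Suc j))"
      using s(2)[of i] s(2)[of j] D_le[OF mid, of i j] by linarith
    finally show ?thesis .
  qed
  have sint: "integrable circle_measure (s n)" for n
    using SD[OF s(1)] S_le[OF s(1)] by (intro integrable_bounded_circle[where B=B]) auto
  have cauchy: "\<exists>N. \<forall>i\<ge>N. \<forall>j\<ge>N. (LINT t|circle_measure. norm (s i t - s j t)) < e" if e: "0 < e" for e
  proof -
    obtain N where N: "inverse (real (Suc N)) < e^2 / 4"
      using reals_Archimedean[of "e^2/4"] e by auto
    have "(LINT t|circle_measure. norm (s i t - s j t)) < e" if "N \<le> i" "N \<le> j" for i j
      unfolding real_norm_def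
    proof (rule integral_abs_less[OF _ _ e, where B=B])
      have "inverse (real (Suc i)) \<le> inverse (real (Suc N))" "inverse (real (Suc j)) \<le> inverse (real (Suc N))"
        using that by (auto intro!: le_imp_inverse_le)
      with N par[of i j] show "(LINT t|circle_measure. (s i t - s j t)^2) < e^2" by linarith
      show "\<bar>s i t - s j t\<bar> \<le> B" for t
        using SD(2)[OF s(1)[of i], of t] SD(2)[OF s(1)[of j], of t] S_le[OF s(1)[of i], of t] S_le[OF s(1)[of j], of t] by auto
    qed (use SD(1)[OF s(1)] in auto)
    then show ?thesis by blast
  qed
  obtain r where r: "strict_mono r" and ae: "AE t in circle_measure. Cauchy (\<lambda>i. s (r i) t)"
    using cauchy_L1_AE_cauchy_subseq[of circle_measure s, OF sint cauchy] .
  \<comment> \<open>Clamping makes the constraints 0 \<le> h \<le> f hold at every point, including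
    those where the subsequence diverges and \<open>lim\<close> is arbitrary.\<close>
  define h where "h t = max 0 (min (f t) (lim (\<lambda>i. s (r i) t)))" for t
  have hm: "h \<in> borel_measurable circle_measure"
    unfolding h_def using f SD(1)[OF s(1)] by measurable
  have lim: "AE t in circle_measure. (\<lambda>i. s (r i) t) \<longlonglongrightarrow> h t"
    using ae
  proof eventually_elim
    case (elim t)
    then have l: "(\<lambda>i. s (r i) t) \<longlonglongrightarrow> lim (\<lambda>i. s (r i) t)"
      using Cauchy_convergent convergent_LIMSEQ_iff by blast
    have "0 \<le> lim (\<lambda>i. s (r i) t)"
      using SD(2)[OF s(1)] by (intro LIMSEQ_le_const[OF l]) auto
    moreover have "lim (\<lambda>i. s (r i) t) \<le> f t"
      using SD(3)[OF s(1)] by (intro LIMSEQ_le_const2[OF l]) auto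
    ultimately show ?case using l by (simp add: h_def)
  qed
  have "\<rho> (\<lambda>t. ennreal (h t)) \<le> 1"
  proof (rule rho_le_of_tendsto)
    show "(\<lambda>t. ennreal (s (r n) t)) \<in> L0_plus" for n
      using SD(1)[OF s(1)] by (simp add: L0_plus_def)
    show "AE t in circle_measure. (\<lambda>n. ennreal (s (r n) t)) \<longlonglongrightarrow> ennreal (h t)"
      using lim by eventually_elim (rule tendsto_ennrealI)
  qed (use hm SD(4)[OF s(1)] in \<open>auto simp: L0_plus_def\<close>)
  then have hS: "h \<in> S"
    using hm fB by (auto simp: S_def h_def)
  have "(\<lambda>i. d (s (r i))) \<longlonglongrightarrow> d h"
    unfolding d_def
  proof (rule integral_dominated_convergence[where w="\<lambda>_. B^2"])
    show "AE t in circle_measure. (\<lambda>i. (f t - s (r i) t)^2) \<longlonglongrightarrow> (f t - h t)^2"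
      using lim by eventually_elim (intro tendsto_intros)
    show "AE t in circle_measure. norm ((f t - s (r i) t)^2) \<le> B^2" for i
      unfolding real_norm_def using SD[OF s(1)] fB S_le[OF s(1)] by (intro AE_I2 sq) auto
  qed (use f hm SD(1)[OF s(1)] in auto)
  moreover have "(\<lambda>i. D + inverse (real (Suc i))) \<longlonglongrightarrow> D + 0"
    by (intro tendsto_intros LIMSEQ_inverse_real_of_nat)
  moreover have "d (s (r i)) \<le> D + inverse (real (Suc i))" for i
  proof -
    have "inverse (real (Suc (r i))) \<le> inverse (real (Suc i))"
      using seq_suble[OF r, of i] by (intro le_imp_inverse_le) auto
    then show ?thesis using s(2)[of "r i"] by linarith
  qed
  ultimately have "d h \<le> D + 0"
    by (intro LIMSEQ_le[of "\<lambda>i. d (s (r i))"]) auto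
  then have "d h \<le> d s'" if "s' \<in> S" for s'
    using D_le[OF that] by simp
  then show ?thesis using that hS unfolding d_def by blast
qed

text \<open>
  The Lorentz--Luxemburg theorem \<open>\<rho>'' = \<rho>\<close>, for bounded functions: \<open>g\<close> is a multiple
  of the vector from the nearest point of the unit ball to \<open>f\<close>.
\<close>

lemma associate_norm_witness:
  fixes f :: "complex \<Rightarrow> real"
  assumes f: "f \<in> borel_measurable circle_measure" and fB: "\<And>t. 0 \<le> f t" "\<And>t. f t \<le> B"
    and big: "1 < \<rho> (\<lambda>t. ennreal (f t))"
  obtains g :: "complex \<Rightarrow> real" where "g \<in> borel_measurable circle_measure" "\<And>t. 0 \<le> g t"
    "associate_norm \<rho> (\<lambda>t. ennreal (g t)) \<le> 1"
    "1 < (\<integral>\<^sup>+t. ennreal (f t) * ennreal (g t) \<partial>circle_measure)"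
proof -
  define S where "S = {s \<in> borel_measurable circle_measure. (\<forall>t. 0 \<le> s t \<and> s t \<le> f t) \<and> \<rho> (\<lambda>t. ennreal (s t)) \<le> 1}"
  obtain h where hS: "h \<in> S" and
    hmin: "\<And>s. s \<in> S \<Longrightarrow> (LINT t|circle_measure. (f t - h t)^2) \<le> (LINT t|circle_measure. (f t - s t)^2)"
    using nearest_point_exists[OF f fB] unfolding S_def by blast
  have hm [measurable]: "h \<in> borel_measurable circle_measure" and h: "\<And>t. 0 \<le> h t" "\<And>t. h t \<le> f t"
    and hr: "\<rho> (\<lambda>t. ennreal (h t)) \<le> 1"
    using hS by (auto simp: S_def)
  note f [measurable]
  define g where "g t = f t - h t" for t
  have gm [measurable]: "g \<in> borel_measurable circle_measure" unfolding g_def by measurable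
  have g0: "0 \<le> g t" for t using h by (simp add: g_def)
  have gB: "g t \<le> B" for t using h(1)[of t] fB(2)[of t] by (simp add: g_def)
  have hB: "h t \<le> B" for t using h(2)[of t] fB(2)[of t] by simp
  \<comment> \<open>The pairing of g with the nearest point h turns out to be the maximum of the
    pairing of g over the unit ball, so g / c has associate norm at most 1.\<close>
  define c where "c = (LINT t|circle_measure. g t * h t)"
  have B0: "0 \<le> B" using fB[of 0] by simp
  have prod_int: "integrable circle_measure (\<lambda>t. x t * y t)"
    if [measurable]: "x \<in> borel_measurable circle_measure" "y \<in> borel_measurable circle_measure"
      and b: "\<And>t. \<bar>x t\<bar> \<le> K" "\<And>t. \<bar>y t\<bar> \<le> L" for x y :: "complex \<Rightarrow> real" and K L
  proof (rule integrable_bounded_circle[where B="K * L"])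
    have "0 \<le> K" using b(1)[of 0] by simp
    then show "\<bar>x t * y t\<bar> \<le> K * L" for t
      unfolding abs_mult using b by (intro mult_mono) auto
  qed measurable
  have var: "(LINT t|circle_measure. g t * s t) \<le> c"
    if sm [measurable]: "s \<in> borel_measurable circle_measure" and s: "\<And>t. 0 \<le> s t" "\<And>t. s t \<le> K" and sr: "\<rho> (\<lambda>t. ennreal (s t)) \<le> 1" for s K
  proof -
    define a where "a = (LINT t|circle_measure. g t * (s t - h t))"
    define b where "b = (LINT t|circle_measure. (s t - h t) * (s t - h t))"
    have shB: "\<bar>s t - h t\<bar> \<le> K + B" for t using s[of t] h(1)[of t] hB[of t] by auto
    have igs: "integrable circle_measure (\<lambda>t. g t * s t)" "integrable circle_measure (\<lambda>t. g t * h t)"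
      and i1: "integrable circle_measure (\<lambda>t. g t * g t)"
      using prod_int[OF gm sm, of B K] prod_int[OF gm hm, of B B] prod_int[OF gm gm, of B B] g0 gB s h hB by auto
    have i2: "integrable circle_measure (\<lambda>t. g t * (s t - h t))"
      using g0 gB shB by (intro prod_int[where K=B and L="K+B"]) auto
    have i3: "integrable circle_measure (\<lambda>t. (s t - h t) * (s t - h t))"
      using shB by (intro prod_int[where K="K+B" and L="K+B"]) auto
    have ab: "2 * a \<le> e * b" if e: "0 < e" "e \<le> 1" for e
    proof -
      \<comment> \<open>The segment from h towards s can leave the region below f, in which h is
        optimal. Truncating at f returns to \<open>S\<close>: it lowers the norm.\<close>
      define s' where "s' t = min (f t) ((1 - e) * h t + e * s t)" for t
      have s'm[measurable]: "s' \<in> borel_measurable circle_measure" unfolding s'_def by measurable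
      have nn: "0 \<le> (1 - e) * h t + e * s t" for t using h s e by simp
      have "\<rho> (\<lambda>t. ennreal (s' t)) \<le> \<rho> (\<lambda>t. ennreal ((1 - e) * h t + e * s t))"
        by (intro rho_mono) (auto simp: L0_plus_def s'_def intro!: ennreal_leI)
      also have "\<dots> \<le> 1" using h s e hr sr by (intro rho_convex) auto
      finally have "s' \<in> S" using nn fB(1) by (auto simp: S_def s'_def)
      from hmin[OF this] have "(LINT t|circle_measure. g t * g t) \<le> (LINT t|circle_measure. (f t - s' t)^2)"
        by (simp add: g_def power2_eq_square)
      also have "\<dots> \<le> (LINT t|circle_measure. g t * g t - 2 * e * (g t * (s t - h t)) + e^2 * ((s t - h t) * (s t - h t)))"
      proof (rule integral_mono)
        show "integrable circle_measure (\<lambda>t. g t * g t - 2 * e * (g t * (s t - h t)) + e^2 * ((s t - h t) * (s t - h t)))"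
          using i1 i2 i3 by (intro Bochner_Integration.integrable_add Bochner_Integration.integrable_diff integrable_mult_right)
        have "\<bar>f t - s' t\<bar> \<le> B" for t
          using fB[of t] nn[of t] by (auto simp: s'_def)
        then show "integrable circle_measure (\<lambda>t. (f t - s' t)^2)"
          unfolding power2_eq_square by (intro prod_int[where K=B and L=B]) auto
        fix t
        \<comment> \<open>Truncation replaces the difference to f by its positive part, so it cannot
          increase the distance and the quadratic expansion along the segment remains an upper
          bound.\<close>
        have "f t - s' t = max 0 (g t - e * (s t - h t))"
          by (auto simp: s'_def g_def algebra_simps min_def max_def)
        then have "\<bar>f t - s' t\<bar> \<le> \<bar>g t - e * (s t - h t)\<bar>" by auto
        then have "(f t - s' t)^2 \<le> (g t - e * (s t - h t))^2" by (simp add: abs_le_square_iff)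
        also have "\<dots> = g t * g t - 2 * e * (g t * (s t - h t)) + e^2 * ((s t - h t) * (s t - h t))"
          by (simp add: power2_eq_square algebra_simps)
        finally show "(f t - s' t)^2 \<le> \<dots>" .
      qed
      also have "\<dots> = (LINT t|circle_measure. g t * g t) - 2 * e * a + e^2 * b"
        using i1 i2 i3 by (simp add: a_def b_def)
      finally have "e * (2 * a) \<le> e * (e * b)" by (simp add: power2_eq_square mult_ac)
      then show ?thesis using e by simp
    qed
    have "a \<le> 0"
    proof (rule ccontr)
      assume "\<not> a \<le> 0"
      then have a: "0 < a" by simp
      \<comment> \<open>This step length forces e * b \<le> a, which is incompatible with 2 * a
        \<le> e * b for positive a.\<close>
      define e where "e = min 1 (a / (\<bar>b\<bar> + 1))"
      have e: "0 < e" "e \<le> 1" using a by (auto simp: e_def)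
      have "e * b \<le> e * (\<bar>b\<bar> + 1)" using e by (intro mult_left_mono) auto
      also have "\<dots> \<le> a / (\<bar>b\<bar> + 1) * (\<bar>b\<bar> + 1)" by (intro mult_right_mono) (auto simp: e_def)
      also have "\<dots> = a" by simp
      finally show False using ab[OF e] a by simp
    qed
    moreover have "a = (LINT t|circle_measure. g t * s t) - c"
      using igs by (simp add: a_def c_def right_diff_distrib)
    ultimately show ?thesis by simp
  qed
  have gint: "integrable circle_measure g"
    using g0 gB by (intro integrable_bounded_circle[where B=B]) auto
  have not0: "\<not> (AE t in circle_measure. g t = 0)"
  proof
    assume "AE t in circle_measure. g t = 0"
    then have "AE t in circle_measure. ennreal (f t) = ennreal (h t)"
      by eventually_elim (simp add: g_def)
    then have "\<rho> (\<lambda>t. ennreal (f t)) = \<rho> (\<lambda>t. ennreal (h t))"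
      by (intro rho_cong_AE) (auto simp: L0_plus_def)
    with big hr show False by simp
  qed
  have "0 < c"
  proof -
    obtain R where R: "\<rho> (\<lambda>_. 1) = ennreal R" "0 \<le> R"
      using rho_one_finite by (cases "\<rho> (\<lambda>_. 1)") auto
    \<comment> \<open>A positive constant function small enough to lie in the unit ball; pairing it
      with g bounds c below by a positive multiple of the integral of g.\<close>
    define \<delta> where "\<delta> = 1 / (1 + R)"
    have \<delta>: "0 < \<delta>" using R by (simp add: \<delta>_def)
    have "\<rho> (\<lambda>t. ennreal \<delta>) \<le> ennreal \<delta> * ennreal R"
      unfolding R(1)[symmetric] using \<delta> by (intro rho_bounded) (auto simp: L0_plus_def)
    also have "\<dots> = ennreal (\<delta> * R)" using \<delta> R by (simp add: ennreal_mult)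
    also have "\<dots> \<le> 1" using R by (simp add: \<delta>_def)
    finally have "(LINT t|circle_measure. g t * \<delta>) \<le> c"
      using \<delta> by (intro var[where K=\<delta>]) auto
    then have "(LINT t|circle_measure. g t) * \<delta> \<le> c" by simp
    moreover have "0 < (LINT t|circle_measure. g t)"
    proof -
      have "0 \<le> (LINT t|circle_measure. g t)" using g0 by simp
      moreover have "(LINT t|circle_measure. g t) \<noteq> 0"
        using integral_nonneg_eq_0_iff_AE[OF gint] g0 not0 by auto
      ultimately show ?thesis by simp
    qed
    ultimately show ?thesis using \<delta> by (smt (verit) mult_pos_pos)
  qed
  define g' where "g' t = g t / c" for t
  have g'm[measurable]: "g' \<in> borel_measurable circle_measure" unfolding g'_def by measurable
  have g'0: "0 \<le> g' t" for t using g0 \<open>0 < c\<close> by (simp add: g'_def)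
  have "associate_norm \<rho> (\<lambda>t. ennreal (g' t)) \<le> 1"
    unfolding associate_norm_def
  proof (rule SUP_least)
    fix s assume "s \<in> {f \<in> L0_plus. \<rho> f \<le> 1}"
    then have sm[measurable]: "s \<in> borel_measurable circle_measure" and sL: "s \<in> L0_plus" and sr: "\<rho> s \<le> 1"
      by (auto simp: L0_plus_def)
    \<comment> \<open>The variational inequality \<open>var\<close> covers bounded s only. A general
      s is truncated at height k, and monotone convergence passes to the limit.\<close>
    have "(\<lambda>k. \<integral>\<^sup>+t. min (s t) (of_nat k) * ennreal (g' t) \<partial>circle_measure) \<longlonglongrightarrow> (\<integral>\<^sup>+t. s t * ennreal (g' t) \<partial>circle_measure)"
    proof (rule nn_integral_LIMSEQ)
      show "incseq (\<lambda>k t. min (s t) (of_nat k) * ennreal (g' t))"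
        by (intro monoI le_funI mult_right_mono min.mono) auto
      show "(\<lambda>k. min (s t) (of_nat k) * ennreal (g' t)) \<longlonglongrightarrow> s t * ennreal (g' t)" for t
        unfolding mult.commute[of _ "ennreal (g' t)"]
        by (intro ennreal_tendsto_cmult tendsto_min_of_nat_ennreal) auto
    qed measurable
    moreover have "(\<integral>\<^sup>+t. min (s t) (of_nat k) * ennreal (g' t) \<partial>circle_measure) \<le> 1" for k
    proof -
      define x where "x t = enn2real (min (s t) (of_nat k))" for t
      have fin: "min (s t) (of_nat k) < \<top>" for t
        using of_nat_less_top[of k] by (simp only: min_less_iff_disj simp_thms)
      have xe: "ennreal (x t) = min (s t) (of_nat k)" for t
        unfolding x_def using fin by (rule ennreal_enn2real)
      have xm[measurable]: "x \<in> borel_measurable circle_measure" unfolding x_def by measurable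
      have x0: "0 \<le> x t" for t by (simp add: x_def)
      have xk: "x t \<le> real k" for t
        using xe[of t] by (metis ennreal_le_iff ennreal_of_nat_eq_real_of_nat min.cobounded2 of_nat_0_le_iff)
      have "\<rho> (\<lambda>t. ennreal (x t)) \<le> \<rho> s"
        unfolding xe by (intro rho_mono sL) (auto simp: L0_plus_def)
      then have "(LINT t|circle_measure. g t * x t) \<le> c"
        using sr by (intro var[where K="real k"] x0 xk) auto
      then have le: "(LINT t|circle_measure. x t * g' t) \<le> 1"
        using \<open>0 < c\<close> by (simp add: g'_def mult.commute divide_le_eq)
      have "integrable circle_measure (\<lambda>t. x t * g' t)"
        using integrable_divide[OF prod_int[OF xm gm, of "real k" B], of c] x0 xk g0 gB by (simp add: g'_def)
      then have "(\<integral>\<^sup>+t. ennreal (x t * g' t) \<partial>circle_measure) = ennreal (LINT t|circle_measure. x t * g' t)"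
        using x0 g'0 by (intro nn_integral_eq_integral) auto
      also have "\<dots> \<le> 1" using le by simp
      finally show ?thesis
        unfolding xe[symmetric] using x0 g'0 by (simp add: ennreal_mult)
    qed
    ultimately show "(\<integral>\<^sup>+t. s t * ennreal (g' t) \<partial>circle_measure) \<le> 1"
      using LIMSEQ_le_const2 by blast
  qed
  moreover have "1 < (\<integral>\<^sup>+t. ennreal (f t) * ennreal (g' t) \<partial>circle_measure)"
  proof -
    have igg: "integrable circle_measure (\<lambda>t. g t * g t)" and igh: "integrable circle_measure (\<lambda>t. g t * h t)"
      using g0 gB h hB by (auto intro!: prod_int[where K=B and L=B])
    have "0 \<le> (LINT t|circle_measure. g t * g t)" by simp
    moreover have "(LINT t|circle_measure. g t * g t) \<noteq> 0"
      using integral_nonneg_eq_0_iff_AE[OF igg] not0 by auto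
    ultimately have pos: "0 < (LINT t|circle_measure. g t * g t)" by (auto simp: less_le)
    \<comment> \<open>Since f = g + h, pairing f with g exceeds c by the squared L2 norm of g, which
      is positive.\<close>
    have "(LINT t|circle_measure. f t * g' t) = (LINT t|circle_measure. (g t * g t + g t * h t) / c)"
      by (intro Bochner_Integration.integral_cong) (auto simp: g'_def g_def field_simps)
    also have "\<dots> = ((LINT t|circle_measure. g t * g t) + c) / c"
      using igg igh by (simp add: c_def)
    also have "\<dots> > 1" using pos \<open>0 < c\<close> by simp
    finally have "1 < (LINT t|circle_measure. f t * g' t)" .
    moreover have "(\<integral>\<^sup>+t. ennreal (f t * g' t) \<partial>circle_measure) = ennreal (LINT t|circle_measure. f t * g' t)"
    proof (rule nn_integral_eq_integral)
      show "integrable circle_measure (\<lambda>t. f t * g' t)"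
        using integrable_divide[OF prod_int[OF f gm, of B B], of c] fB g0 gB by (simp add: g'_def)
    qed (use fB g'0 in auto)
    ultimately show ?thesis
      using fB g'0 by (simp add: ennreal_mult)
  qed
  ultimately show ?thesis using that[of g'] g'm g'0 by blast
qed

end

section \<open>Uniform boundedness and absolute continuity of the norm\<close>

lemma vp_measurable:
  assumes "integrable circle_measure f"
  shows "vp n f \<in> borel_measurable circle_measure"
proof -
  have "(\<lambda>t. \<Sum>j\<le>2*n. of_real (vp_coeff n j) * fourier_coeff f (int j - int n) * t powi (int j - int n)) \<in> borel_measurable circle_measure"
    by (rule borel_imp_circle_measure) measurable
  then show ?thesis
    using vp_eq_sum[OF assms] by (subst measurable_cong) auto
qed

lemma kernel_integrable:
  fixes f :: "complex \<Rightarrow> complex"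
  assumes f: "integrable circle_measure f" and t: "cmod t = 1"
  shows "integrable circle_measure (\<lambda>s. of_real (vp_kernel n (Re (t * cnj s))) * f s)"
proof (rule integrable_mult_bounded_circle[OF f])
  fix s :: complex assume s: "cmod s = 1"
  show "cmod (of_real (vp_kernel n (Re (t * cnj s)))) \<le> vp_kernel n 1"
    using vp_kernel_nonneg[OF Re_sphere_bounds(1)[OF t s]] vp_kernel_mono[OF Re_sphere_bounds[OF t s]]
    by simp
qed (intro borel_measurable_continuous_onI continuous_intros)

lemma vp_diff:
  assumes "integrable circle_measure f" "integrable circle_measure g" "cmod t = 1"
  shows "vp n (\<lambda>s. f s - g s) t = vp n f t - vp n g t"
  unfolding vp_def right_diff_distrib
  using kernel_integrable[OF assms(1,3)] kernel_integrable[OF assms(2,3)] by simp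

lemma vp_add:
  assumes "integrable circle_measure f" "integrable circle_measure g" "cmod t = 1"
  shows "vp n (\<lambda>s. f s + g s) t = vp n f t + vp n g t"
  unfolding vp_def distrib_left
  using kernel_integrable[OF assms(1,3)] kernel_integrable[OF assms(2,3)] by simp

lemma vp_cmult: "vp n (\<lambda>s. c * f s) t = c * vp n f t"
  by (simp add: vp_def mult.left_commute[of _ c])

lemma norm_vp_le:
  assumes f: "integrable circle_measure f" and t: "cmod t = 1"
  shows "ennreal (cmod (vp n f t)) \<le> (\<integral>\<^sup>+s. ennreal (vp_kernel n (Re (t * cnj s))) * ennreal (cmod (f s)) \<partial>circle_measure)"
proof -
  have "ennreal (cmod (vp n f t)) \<le> (\<integral>\<^sup>+s. norm (of_real (vp_kernel n (Re (t * cnj s))) * f s) \<partial>circle_measure)"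
    unfolding vp_def by (rule integral_norm_bound_ennreal[OF kernel_integrable[OF assms]])
  also have "\<dots> = (\<integral>\<^sup>+s. ennreal (vp_kernel n (Re (t * cnj s))) * ennreal (cmod (f s)) \<partial>circle_measure)"
  proof (rule nn_integral_cong)
    fix s assume "s \<in> space circle_measure"
    then have s: "cmod s = 1" by simp
    have "norm (of_real (vp_kernel n (Re (t * cnj s))) * f s) = vp_kernel n (Re (t * cnj s)) * cmod (f s)"
      using vp_kernel_nonneg[OF Re_sphere_bounds(1)[OF t s]] by (simp add: norm_mult)
    then show "ennreal (norm (of_real (vp_kernel n (Re (t * cnj s))) * f s)) = ennreal (vp_kernel n (Re (t * cnj s))) * ennreal (cmod (f s))"
      using vp_kernel_nonneg[OF Re_sphere_bounds(1)[OF t s]] by (simp add: ennreal_mult)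
  qed
  finally show ?thesis .
qed

text \<open>By symmetry of the kernel, averaging can be moved from \<open>f\<close> to \<open>g\<close>.\<close>

lemma nn_integral_vp_duality:
  assumes f: "integrable circle_measure f" and g: "g \<in> borel_measurable circle_measure"
  shows "(\<integral>\<^sup>+t. ennreal (cmod (vp n f t)) * ennreal (cmod (g t)) \<partial>circle_measure)
    \<le> (\<integral>\<^sup>+s. ennreal (cmod (f s)) * hl_maximal g s \<partial>circle_measure)"
proof -
  interpret pair_sigma_finite circle_measure circle_measure ..
  have f'[measurable]: "f \<in> borel_measurable circle_measure" using f by simp
  note g[measurable]
  have id: "(\<lambda>x. x) \<in> circle_measure \<rightarrow>\<^sub>M borel"
    by (rule borel_imp_circle_measure) simp
  define K where "K t s = ennreal (vp_kernel n (Re (t * cnj s)))" for t s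
  have Km[measurable]: "(\<lambda>x. K (fst x) (snd x)) \<in> borel_measurable (circle_measure \<Otimes>\<^sub>M circle_measure)"
  proof -
    have 1: "(\<lambda>x. fst x) \<in> borel_measurable (circle_measure \<Otimes>\<^sub>M circle_measure)"
      by (rule measurable_compose[OF measurable_fst id])
    have 2: "(\<lambda>x. snd x) \<in> borel_measurable (circle_measure \<Otimes>\<^sub>M circle_measure)"
      by (rule measurable_compose[OF measurable_snd id])
    have 3: "(\<lambda>x. cnj (snd x)) \<in> borel_measurable (circle_measure \<Otimes>\<^sub>M circle_measure)"
      by (rule measurable_compose[OF 2 borel_measurable_cnj])
    have "(\<lambda>x. fst x * cnj (snd x)) \<in> borel_measurable (circle_measure \<Otimes>\<^sub>M circle_measure)"
      by (rule borel_measurable_times[OF 1 3])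
    from measurable_compose[OF this, of "\<lambda>z. ennreal (vp_kernel n (Re z))" borel]
    show ?thesis by (simp add: K_def)
  qed
  have fe: "(\<lambda>s. ennreal (cmod (f s))) \<in> borel_measurable circle_measure"
    using f' by simp
  have Km1: "K t \<in> borel_measurable circle_measure" for t
    unfolding K_def by (rule borel_imp_circle_measure) measurable
  have Km2: "(\<lambda>t. K t s) \<in> borel_measurable circle_measure" for s
    unfolding K_def by (rule borel_imp_circle_measure) measurable
  have "(\<integral>\<^sup>+t. ennreal (cmod (vp n f t)) * ennreal (cmod (g t)) \<partial>circle_measure)
     \<le> (\<integral>\<^sup>+t. (\<integral>\<^sup>+s. K t s * ennreal (cmod (f s)) \<partial>circle_measure) * ennreal (cmod (g t)) \<partial>circle_measure)"
    unfolding K_def by (intro nn_integral_mono mult_right_mono norm_vp_le[OF f]) auto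
  also have "\<dots> = (\<integral>\<^sup>+t. (\<integral>\<^sup>+s. K t s * ennreal (cmod (f s)) * ennreal (cmod (g t)) \<partial>circle_measure) \<partial>circle_measure)"
    by (intro nn_integral_cong nn_integral_multc[symmetric] borel_measurable_times_ennreal Km1 fe)
  \<comment> \<open>Tonelli: everything is nonnegative, and \<open>Km\<close> provides joint
    measurability for the product of the completed measures.\<close>
  also have "\<dots> = (\<integral>\<^sup>+s. (\<integral>\<^sup>+t. K t s * ennreal (cmod (f s)) * ennreal (cmod (g t)) \<partial>circle_measure) \<partial>circle_measure)"
    by (intro Fubini'[symmetric]) measurable
  also have "\<dots> = (\<integral>\<^sup>+s. ennreal (cmod (f s)) * (\<integral>\<^sup>+t. K t s * ennreal (cmod (g t)) \<partial>circle_measure) \<partial>circle_measure)"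
    using Km2 by (intro nn_integral_cong, subst nn_integral_cmult[symmetric]) (auto simp: mult_ac)
  also have "\<dots> \<le> (\<integral>\<^sup>+s. ennreal (cmod (f s)) * hl_maximal g s \<partial>circle_measure)"
    unfolding K_def by (intro nn_integral_mono mult_left_mono nn_integral_vp_kernel_le_hl_maximal[OF g]) auto
  finally show ?thesis .
qed

section \<open>Norm calculus in X, the uniform bound, and dominated convergence\<close>

context banach_function_norm
begin

lemma bfs_measurable: "f \<in> bfs \<rho> \<Longrightarrow> f \<in> borel_measurable circle_measure"
  by (simp add: bfs_def L0_def)

lemma bfs_integrable:
  assumes "f \<in> bfs \<rho>"
  shows "integrable circle_measure f"
proof (rule integrableI_bounded)
  note m = bfs_measurable[OF assms]
  show "f \<in> borel_measurable circle_measure" by (rule m)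
  obtain C :: real where C: "\<And>f. f \<in> L0_plus \<Longrightarrow> (\<integral>\<^sup>+t\<in>space circle_measure. f t \<partial>circle_measure) \<le> ennreal C * \<rho> f"
    using integral_bound[OF sets.top] by blast
  have "(\<integral>\<^sup>+t. ennreal (cmod (f t)) \<partial>circle_measure) = (\<integral>\<^sup>+t\<in>space circle_measure. ennreal (cmod (f t)) \<partial>circle_measure)"
    by (intro nn_integral_cong) (simp del: space_circle_measure)
  also have "\<dots> \<le> ennreal C * bfs_norm \<rho> f"
    unfolding bfs_norm_def using m by (intro C) (simp add: L0_plus_def)
  also have "\<dots> < \<infinity>" using assms by (auto simp: bfs_def ennreal_mult_less_top)
  finally show "(\<integral>\<^sup>+t. ennreal (norm (f t)) \<partial>circle_measure) < \<infinity>" .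
qed

lemma vp_L0: "f \<in> bfs \<rho> \<Longrightarrow> vp n f \<in> L0"
  unfolding L0_def by (intro vp_measurable bfs_integrable)

lemma bfs_norm_mono:
  assumes "f \<in> L0" "g \<in> L0" "\<And>t. cmod t = 1 \<Longrightarrow> cmod (f t) \<le> cmod (g t)"
  shows "bfs_norm \<rho> f \<le> bfs_norm \<rho> g"
  unfolding bfs_norm_def using assms by (intro rho_mono) (auto simp: L0_def L0_plus_def intro: ennreal_leI)

lemma bfs_norm_cong:
  assumes "f \<in> L0" "g \<in> L0" "\<And>t. cmod t = 1 \<Longrightarrow> f t = g t"
  shows "bfs_norm \<rho> f = bfs_norm \<rho> g"
  by (intro antisym bfs_norm_mono) (use assms in auto)

lemma bfs_norm_add:
  assumes "f \<in> L0" "g \<in> L0"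
  shows "bfs_norm \<rho> (\<lambda>t. f t + g t) \<le> bfs_norm \<rho> f + bfs_norm \<rho> g"
proof -
  have "bfs_norm \<rho> (\<lambda>t. f t + g t) \<le> \<rho> (\<lambda>t. ennreal (cmod (f t)) + ennreal (cmod (g t)))"
    unfolding bfs_norm_def using assms
    by (intro rho_mono) (auto simp: L0_def L0_plus_def norm_triangle_ineq simp flip: ennreal_plus)
  also have "\<dots> \<le> bfs_norm \<rho> f + bfs_norm \<rho> g"
    unfolding bfs_norm_def using assms by (intro triangle) (auto simp: L0_def L0_plus_def)
  finally show ?thesis .
qed

lemma bfs_norm_cmult:
  assumes "f \<in> L0"
  shows "bfs_norm \<rho> (\<lambda>t. c * f t) = ennreal (cmod c) * bfs_norm \<rho> f"
  unfolding bfs_norm_def norm_mult using assms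
  by (subst homogeneous[symmetric]) (auto simp: L0_def L0_plus_def ennreal_mult)

lemma bfs_norm_minus_commute: "bfs_norm \<rho> (\<lambda>t. f t - g t) = bfs_norm \<rho> (\<lambda>t. g t - f t)"
  by (simp add: bfs_norm_def norm_minus_commute)

lemma bfs_norm_triangle:
  assumes "f \<in> L0" "g \<in> L0" "h \<in> L0"
  shows "bfs_norm \<rho> (\<lambda>t. f t - h t) \<le> bfs_norm \<rho> (\<lambda>t. f t - g t) + bfs_norm \<rho> (\<lambda>t. g t - h t)"
  using bfs_norm_add[of "\<lambda>t. f t - g t" "\<lambda>t. g t - h t"] assms by (simp add: L0_def)

lemma bfs_add: "f \<in> bfs \<rho> \<Longrightarrow> g \<in> bfs \<rho> \<Longrightarrow> (\<lambda>t. f t + g t) \<in> bfs \<rho>"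
  using bfs_norm_add[of f g] by (auto simp: bfs_def L0_def intro: le_less_trans)

lemma bfs_cmult: "f \<in> bfs \<rho> \<Longrightarrow> (\<lambda>t. c * f t) \<in> bfs \<rho>"
  using bfs_norm_cmult[of f c] by (auto simp: bfs_def L0_def ennreal_mult_less_top)

lemma bfs_diff: "f \<in> bfs \<rho> \<Longrightarrow> g \<in> bfs \<rho> \<Longrightarrow> (\<lambda>t. f t - g t) \<in> bfs \<rho>"
  using bfs_add[of f "\<lambda>t. -1 * g t"] bfs_cmult[of g "-1"] by simp

lemma bfs_norm_bounded:
  assumes "f \<in> L0" "\<And>t. cmod t = 1 \<Longrightarrow> cmod (f t) \<le> B" "0 \<le> B"
  shows "bfs_norm \<rho> f \<le> ennreal B * \<rho> (\<lambda>_. 1)"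
  unfolding bfs_norm_def using assms
  by (intro rho_bounded AE_I2) (auto simp: L0_def L0_plus_def intro: ennreal_leI)

lemma bfs_bounded:
  assumes "f \<in> L0" "\<And>t. cmod t = 1 \<Longrightarrow> cmod (f t) \<le> B"
  shows "f \<in> bfs \<rho>"
proof -
  have "0 \<le> B" using assms(2)[of 1] by (simp add: order_trans[OF norm_ge_zero])
  then have "bfs_norm \<rho> f \<le> ennreal B * \<rho> (\<lambda>_. 1)"
    using assms by (intro bfs_norm_bounded)
  also have "\<dots> < \<infinity>" using rho_one_finite by (auto simp: ennreal_mult_less_top)
  finally show ?thesis using assms by (simp add: bfs_def)
qed

text \<open>Were the norm above c, a multiple of the convolution of norm above 1 would pair to more
  than 1 with some g in the unit ball of X'. Moving the kernel onto g produces
  \<open>hl_maximal\<close>, whose associate norm is at most c, a contradiction.\<close>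

lemma vp_bounded_unit:
  assumes hl: "\<And>g. g \<in> bfs (associate_norm \<rho>) \<Longrightarrow> associate_norm \<rho> (hl_maximal g) \<le> c * bfs_norm (associate_norm \<rho>) g"
    and f: "f \<in> bfs \<rho>" and f1: "bfs_norm \<rho> f \<le> 1"
  shows "bfs_norm \<rho> (vp n f) \<le> c"
proof (rule ccontr)
  assume "\<not> bfs_norm \<rho> (vp n f) \<le> c"
  then have "c < bfs_norm \<rho> (vp n f)" by simp
  \<comment> \<open>A number strictly between is finite even if the norm is infinite, so dividing by
    it is meaningful and leaves a norm above 1.\<close>
  then obtain a' where a': "c < a'" "a' < bfs_norm \<rho> (vp n f)"
    using dense by blast
  define a where "a = enn2real a'"
  have a: "a' = ennreal a" "0 < a"
  proof -
    have "a' < \<top>" using a'(2) by (metis less_top order.strict_trans1 not_less_iff_gr_or_eq top.not_eq_extremum)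
    then show "a' = ennreal a" by (simp add: a_def)
    moreover have "0 < a'" using a'(1) by (rule le_less_trans[OF zero_le])
    ultimately show "0 < a" by simp
  qed
  note fi = bfs_integrable[OF f]
  \<comment> \<open>The kernel is largest at 1, so the convolution is bounded by a multiple of the
    L1 norm of f; \<open>associate_norm_witness\<close> asks for such a bound.\<close>
  define B where "B = enn2real (ennreal (vp_kernel n 1) * (\<integral>\<^sup>+s. ennreal (cmod (f s)) \<partial>circle_measure)) / a"
  have fin: "(\<integral>\<^sup>+s. ennreal (cmod (f s)) \<partial>circle_measure) < \<infinity>"
    using fi by (simp add: integrable_iff_bounded)
  have B: "cmod (vp n f t) / a \<le> B" if t: "cmod t = 1" for t
  proof -
    have "ennreal (cmod (vp n f t)) \<le> (\<integral>\<^sup>+s. ennreal (vp_kernel n (Re (t * cnj s))) * ennreal (cmod (f s)) \<partial>circle_measure)"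
      by (rule norm_vp_le[OF fi t])
    also have "\<dots> \<le> (\<integral>\<^sup>+s. ennreal (vp_kernel n 1) * ennreal (cmod (f s)) \<partial>circle_measure)"
      by (intro nn_integral_mono mult_right_mono ennreal_leI vp_kernel_mono Re_sphere_bounds t) auto
    also have "\<dots> = ennreal (vp_kernel n 1) * (\<integral>\<^sup>+s. ennreal (cmod (f s)) \<partial>circle_measure)"
      using fi by (intro nn_integral_cmult) auto
    finally have "enn2real (ennreal (cmod (vp n f t))) \<le> enn2real (ennreal (vp_kernel n 1) * (\<integral>\<^sup>+s. ennreal (cmod (f s)) \<partial>circle_measure))"
      using fin by (intro enn2real_mono) (auto simp: ennreal_mult_less_top)
    then show ?thesis unfolding B_def using a by (intro divide_right_mono) auto
  qed
  \<comment> \<open>The indicator supplies bounds at every complex t, as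
    \<open>associate_norm_witness\<close> requires; off the circle \<open>vp n f\<close> is
    uncontrolled.\<close>
  define F where "F t = indicat_real (sphere 0 1) t * (cmod (vp n f t) / a)" for t
  have sph: "sphere 0 1 \<in> sets circle_measure" using sets.top[of circle_measure] by simp
  have vm[measurable]: "vp n f \<in> borel_measurable circle_measure" by (rule vp_measurable[OF fi])
  have Fm[measurable]: "F \<in> borel_measurable circle_measure"
    unfolding F_def using sph by measurable
  have "0 \<le> cmod (vp n f 1) / a" using a by simp
  then have B0: "0 \<le> B" using B[of 1] by simp
  have F0: "0 \<le> F t" for t using a by (simp add: F_def)
  have FB: "F t \<le> B" for t using B B0 by (auto simp: F_def split: split_indicator)
  have Feq: "F t = cmod (vp n f t) / a" if "cmod t = 1" for t using that by (simp add: F_def)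
  have scale: "bfs_norm \<rho> (vp n f) = ennreal a * \<rho> (\<lambda>t. ennreal (F t))"
  proof -
    have "ennreal a * \<rho> (\<lambda>t. ennreal (F t)) = \<rho> (\<lambda>t. ennreal a * ennreal (F t))"
      using Fm a by (intro homogeneous[symmetric]) (auto simp: L0_plus_def)
    also have "\<dots> = bfs_norm \<rho> (vp n f)"
      unfolding bfs_norm_def
      using Fm a by (intro rho_cong_AE AE_I2) (auto simp: L0_plus_def Feq simp flip: ennreal_mult)
    finally show ?thesis ..
  qed
  have "1 < \<rho> (\<lambda>t. ennreal (F t))"
  proof (rule ccontr)
    assume "\<not> 1 < \<rho> (\<lambda>t. ennreal (F t))"
    then have "ennreal a * \<rho> (\<lambda>t. ennreal (F t)) \<le> ennreal a * 1" by (intro mult_left_mono) auto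
    then show False using scale a' a by simp
  qed
  then obtain g where g[measurable]: "g \<in> borel_measurable circle_measure" and g0: "\<And>t. 0 \<le> g t"
    and g1: "associate_norm \<rho> (\<lambda>t. ennreal (g t)) \<le> 1"
    and gF: "1 < (\<integral>\<^sup>+t. ennreal (F t) * ennreal (g t) \<partial>circle_measure)"
    using associate_norm_witness[OF Fm F0 FB] by blast
  define G where "G t = complex_of_real (g t)" for t
  have cG: "cmod (G t) = g t" for t using g0 by (simp add: G_def)
  have Gm: "G \<in> borel_measurable circle_measure" unfolding G_def by measurable
  have Gn: "bfs_norm (associate_norm \<rho>) G \<le> 1" using g1 by (simp add: bfs_norm_def cG)
  then have Gb: "G \<in> bfs (associate_norm \<rho>)"
    using Gm by (auto simp: bfs_def L0_def intro: le_less_trans)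
  have "ennreal a * (\<integral>\<^sup>+t. ennreal (F t) * ennreal (g t) \<partial>circle_measure) = (\<integral>\<^sup>+t. ennreal a * (ennreal (F t) * ennreal (g t)) \<partial>circle_measure)"
    by (intro nn_integral_cmult[symmetric]) measurable
  also have "\<dots> = (\<integral>\<^sup>+t. ennreal (cmod (vp n f t)) * ennreal (cmod (G t)) \<partial>circle_measure)"
  proof (rule nn_integral_cong)
    fix t assume "t \<in> space circle_measure"
    then have "ennreal a * ennreal (F t) = ennreal (cmod (vp n f t))"
      using a by (simp add: Feq flip: ennreal_mult)
    then show "ennreal a * (ennreal (F t) * ennreal (g t)) = ennreal (cmod (vp n f t)) * ennreal (cmod (G t))"
      by (simp add: cG mult.assoc[symmetric])
  qed
  also have "\<dots> \<le> (\<integral>\<^sup>+s. ennreal (cmod (f s)) * hl_maximal G s \<partial>circle_measure)"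
    by (rule nn_integral_vp_duality[OF fi Gm])
  \<comment> \<open>The modulus of f has norm at most 1, so it competes in the supremum that defines
    the associate norm.\<close>
  also have "\<dots> \<le> associate_norm \<rho> (hl_maximal G)"
    unfolding associate_norm_def using f1 bfs_measurable[OF f]
    by (intro SUP_upper2[of "\<lambda>s. ennreal (cmod (f s))"]) (auto simp: L0_plus_def bfs_norm_def)
  also have "\<dots> \<le> c * bfs_norm (associate_norm \<rho>) G" by (rule hl[OF Gb])
  also have "\<dots> \<le> c * 1" using Gn by (intro mult_left_mono) auto
  finally have "ennreal a * (\<integral>\<^sup>+t. ennreal (F t) * ennreal (g t) \<partial>circle_measure) \<le> c" by simp
  moreover have "ennreal a * 1 \<le> ennreal a * (\<integral>\<^sup>+t. ennreal (F t) * ennreal (g t) \<partial>circle_measure)"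
    using gF by (intro mult_left_mono) auto
  ultimately have "ennreal a \<le> c" by (metis mult_1_right order_trans)
  then show False using a a'(1) by simp
qed

text \<open>Scaling by an upper bound r > 0, and not by the norm itself, also covers functions of
  norm 0.\<close>

lemma vp_bounded:
  assumes hl: "\<And>g. g \<in> bfs (associate_norm \<rho>) \<Longrightarrow> associate_norm \<rho> (hl_maximal g) \<le> c * bfs_norm (associate_norm \<rho>) g"
    and f: "f \<in> bfs \<rho>" and r: "0 < r" "bfs_norm \<rho> f \<le> ennreal r"
  shows "bfs_norm \<rho> (vp n f) \<le> c * ennreal r"
proof -
  define \<phi> where "\<phi> t = of_real (1 / r) * f t" for t
  have \<phi>: "\<phi> \<in> bfs \<rho>" unfolding \<phi>_def by (rule bfs_cmult[OF f])
  have "bfs_norm \<rho> \<phi> = ennreal (1 / r) * bfs_norm \<rho> f"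
    unfolding \<phi>_def using f r by (subst bfs_norm_cmult) (auto simp: bfs_def norm_divide)
  also have "\<dots> \<le> ennreal (1 / r) * ennreal r" using r by (intro mult_left_mono) auto
  also have "\<dots> = 1" using r by (simp flip: ennreal_mult)
  finally have "bfs_norm \<rho> (vp n \<phi>) \<le> c" using vp_bounded_unit[OF hl \<phi>] by simp
  then have "ennreal r * bfs_norm \<rho> (vp n \<phi>) \<le> c * ennreal r"
    by (subst mult.commute) (rule mult_right_mono, auto)
  moreover have "vp n f = (\<lambda>t. of_real r * vp n \<phi> t)"
    using r by (auto simp: \<phi>_def simp flip: vp_cmult)
  moreover have "bfs_norm \<rho> (\<lambda>t. of_real r * vp n \<phi> t) = ennreal r * bfs_norm \<rho> (vp n \<phi>)"
    using r vp_L0[OF \<phi>] by (subst bfs_norm_cmult) auto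
  ultimately show ?thesis by simp
qed

text \<open>If the norms stay above e, the Fatou axiom finds disjoint pieces \<open>A k\<close> on
  each of which h has norm above e/2. Restricting h to unions of pieces, one for each set of
  naturals, yields uncountably many functions at mutual distance above e/2, which separability
  excludes.\<close>

lemma absolutely_continuous_norm:
  fixes h :: "complex \<Rightarrow> real"
  assumes sep: "bfs_separable \<rho>"
    and h: "h \<in> borel_measurable circle_measure" "\<And>t. 0 \<le> h t" "\<rho> (\<lambda>t. ennreal (h t)) < \<infinity>"
    and E: "\<And>n. E n \<in> sets circle_measure" "decseq E" "AE t in circle_measure. t \<notin> (\<Inter>n. E n)"
    and e: "0 < e"
  shows "\<exists>n. \<rho> (\<lambda>t. ennreal (h t * indicator (E n) t)) < ennreal e"
proof (rule ccontr)
  assume "\<not> ?thesis"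
  then have big: "ennreal e \<le> \<rho> (\<lambda>t. ennreal (h t * indicator (E n) t))" for n
    by (auto simp: not_less)
  note h(1)[measurable] E(1)[measurable]
  have "\<exists>m>n. ennreal (e / 2) < \<rho> (\<lambda>t. ennreal (h t * indicator (E n - E m) t))" for n
  proof -
    have "incseq (\<lambda>m. \<rho> (\<lambda>t. ennreal (h t * indicator (E n - E m) t))) \<and>
      (\<lambda>m. \<rho> (\<lambda>t. ennreal (h t * indicator (E n - E m) t))) \<longlonglongrightarrow> \<rho> (\<lambda>t. ennreal (h t * indicator (E n) t))"
    proof (rule fatou)
      show "AE t in circle_measure. incseq (\<lambda>m. ennreal (h t * indicator (E n - E m) t)) \<and>
          (\<lambda>m. ennreal (h t * indicator (E n - E m) t)) \<longlonglongrightarrow> ennreal (h t * indicator (E n) t)"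
        using E(3)
      proof eventually_elim
        case (elim t)
        then obtain m where m: "t \<notin> E m" by auto
        then have m': "t \<notin> E k" if "m \<le> k" for k
          using decseqD[OF E(2) that] by auto
        have "eventually (\<lambda>k. ennreal (h t * indicator (E n) t) = ennreal (h t * indicator (E n - E k) t)) sequentially"
          using eventually_ge_at_top[of m] by eventually_elim (use m' in \<open>auto split: split_indicator\<close>)
        then have "(\<lambda>k. ennreal (h t * indicator (E n - E k) t)) \<longlonglongrightarrow> ennreal (h t * indicator (E n) t)"
          by (rule Lim_transform_eventually[OF tendsto_const])
        moreover have "incseq (\<lambda>k. ennreal (h t * indicator (E n - E k) t))"
          using h(2) E(2) by (intro monoI ennreal_leI mult_left_mono) (auto split: split_indicator dest: decseqD)
        ultimately show ?case by simp
      qed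
    qed (auto simp: L0_plus_def)
    moreover have "ennreal (e / 2) < \<rho> (\<lambda>t. ennreal (h t * indicator (E n) t))"
      using e by (intro less_le_trans[OF _ big]) (simp add: ennreal_lessI)
    ultimately have "eventually (\<lambda>m. ennreal (e / 2) < \<rho> (\<lambda>t. ennreal (h t * indicator (E n - E m) t))) sequentially"
      using order_tendstoD(1) by blast
    then have "eventually (\<lambda>m. n < m \<and> ennreal (e / 2) < \<rho> (\<lambda>t. ennreal (h t * indicator (E n - E m) t))) sequentially"
      by (intro eventually_conj eventually_gt_at_top)
    then show ?thesis by (auto simp: eventually_sequentially)
  qed
  then obtain N where N: "\<And>n. n < N n" "\<And>n. ennreal (e / 2) < \<rho> (\<lambda>t. ennreal (h t * indicator (E n - E (N n)) t))"
    by metis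
  \<comment> \<open>Iterating \<open>N\<close> from 0 gives indices along which consecutive
    differences of the decreasing sets are disjoint and still carry norm above e/2.\<close>
  define v where "v k = (N ^^ k) 0" for k
  have v: "v k < v (Suc k)" for k using N(1) by (simp add: v_def)
  then have vm: "v k \<le> v l" if "k \<le> l" for k l
    using that by (meson lift_Suc_mono_le less_imp_le)
  define A where "A k = E (v k) - E (v (Suc k))" for k
  have A[measurable]: "A k \<in> sets circle_measure" for k unfolding A_def by measurable
  have Abig: "ennreal (e / 2) < \<rho> (\<lambda>t. ennreal (h t * indicator (A k) t))" for k
    using N(2)[of "v k"] by (simp add: A_def v_def)
  have disj: "k = l" if "t \<in> A k" "t \<in> A l" for t k l
  proof (rule ccontr)
    assume "k \<noteq> l"
    moreover have False if "k < l" "t \<in> A k" "t \<in> A l" for k l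
      using that vm[of "Suc k" l] decseqD[OF E(2), of "v (Suc k)" "v l"] by (auto simp: A_def)
    ultimately show False using that by (metis linorder_neqE_nat)
  qed
  define f where "f S t = complex_of_real (h t * indicator (\<Union>k\<in>S. A k) t)" for S t
  have fm: "f S \<in> L0" for S
  proof -
    have "(\<Union>k\<in>S. A k) \<in> sets circle_measure" by (intro sets.countable_UN' A) auto
    then show ?thesis unfolding f_def L0_def by measurable
  qed
  have fb: "f S \<in> bfs \<rho>" for S
  proof -
    have "bfs_norm \<rho> (f S) \<le> \<rho> (\<lambda>t. ennreal (h t))"
      unfolding bfs_norm_def using fm[of S] h
      by (intro rho_mono) (auto simp: L0_def L0_plus_def f_def intro!: ennreal_leI split: split_indicator)
    with h(3) fm show ?thesis by (auto simp: bfs_def intro: le_less_trans)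
  qed
  obtain D where D: "countable D" "D \<subseteq> bfs \<rho>"
    "\<And>f \<epsilon>::real. f \<in> bfs \<rho> \<Longrightarrow> 0 < \<epsilon> \<Longrightarrow> \<exists>d\<in>D. bfs_norm \<rho> (\<lambda>t. f t - d t) < ennreal \<epsilon>"
    using sep unfolding bfs_separable_def bfs_dense_def by blast
  \<comment> \<open>With radius e/4, two functions sharing an approximant would be within e/2 of
    each other, so the choice of approximant is injective.\<close>
  have "\<exists>d\<in>D. bfs_norm \<rho> (\<lambda>t. f S t - d t) < ennreal (e / 4)" for S
    using e by (intro D(3) fb) auto
  then obtain d where d: "\<And>S. d S \<in> D" "\<And>S. bfs_norm \<rho> (\<lambda>t. f S t - d S t) < ennreal (e / 4)" by metis
  have "inj d"
  proof (rule injI, rule ccontr)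
    fix S T assume eq: "d S = d T" and "S \<noteq> T"
    then obtain k where k: "(k \<in> S) \<noteq> (k \<in> T)" by auto
    have dL: "d S \<in> L0" using d(1) D(2) by (auto simp: bfs_def)
    have "\<rho> (\<lambda>t. ennreal (h t * indicator (A k) t)) \<le> bfs_norm \<rho> (\<lambda>t. f S t - f T t)"
      unfolding bfs_norm_def
    proof (rule rho_mono)
      fix t
      show "ennreal (h t * indicator (A k) t) \<le> ennreal (cmod (f S t - f T t))"
      proof (cases "t \<in> A k")
        case True
        then have "t \<in> (\<Union>k\<in>S. A k) \<longleftrightarrow> k \<in> S" "t \<in> (\<Union>k\<in>T. A k) \<longleftrightarrow> k \<in> T"
          using disj by blast+
        then show ?thesis using k h(2)[of t] by (auto simp: f_def split: split_indicator)
      qed simp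
    qed (use fm in \<open>auto simp: L0_def L0_plus_def\<close>)
    also have "\<dots> \<le> bfs_norm \<rho> (\<lambda>t. f S t - d S t) + bfs_norm \<rho> (\<lambda>t. d S t - f T t)"
      by (intro bfs_norm_triangle fm dL)
    also have "\<dots> = bfs_norm \<rho> (\<lambda>t. f S t - d S t) + bfs_norm \<rho> (\<lambda>t. f T t - d T t)"
      by (simp only: eq bfs_norm_minus_commute[of "f T"])
    also have "\<dots> \<le> ennreal (e / 4) + ennreal (e / 4)"
      using d(2) by (intro add_mono less_imp_le)
    also have "\<dots> = ennreal (e / 2)" using e by (simp flip: ennreal_plus)
    finally show False using Abig[of k] by simp
  qed
  then have "countable (UNIV :: nat set set)"
    using D(1) d(1) by (metis countable_image_inj_on countable_subset image_subsetI)
  then have "range (from_nat_into (UNIV :: nat set set)) = Pow UNIV"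
    by (simp add: range_from_nat_into)
  then show False using Cantors_theorem[of "UNIV :: nat set"] by blast
qed

text \<open>\<open>E n\<close> collects the points where some term from index n on exceeds \<delta>;
  these sets decrease to a null set. On \<open>E n\<close> the majorant h has small norm by absolute
  continuity, and off it the n-th term is at most \<delta>.\<close>

lemma rho_dominated_convergence:
  fixes h :: "complex \<Rightarrow> real"
  assumes sep: "bfs_separable \<rho>"
    and h: "h \<in> borel_measurable circle_measure" "\<And>t. 0 \<le> h t" "\<rho> (\<lambda>t. ennreal (h t)) < \<infinity>"
    and f: "\<And>n. f n \<in> L0" "\<And>n t. cmod t = 1 \<Longrightarrow> cmod (f n t) \<le> h t"
    and lim: "AE t in circle_measure. (\<lambda>n. f n t) \<longlonglongrightarrow> 0" and e: "0 < e"
  shows "\<exists>n. bfs_norm \<rho> (f n) < ennreal e"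
proof -
  have fm[measurable]: "f n \<in> borel_measurable circle_measure" for n
    using f by (simp add: L0_def)
  obtain R where R: "\<rho> (\<lambda>_. 1) = ennreal R" "0 \<le> R"
    using rho_one_finite by (cases "\<rho> (\<lambda>_. 1)") auto
  define \<delta> where "\<delta> = e / (2 * (1 + R))"
  have \<delta>: "0 < \<delta>" "\<delta> * R \<le> e / 2"
    using R e by (auto simp: \<delta>_def field_simps)
  define E where "E n = {t \<in> space circle_measure. \<exists>k\<ge>n. \<delta> < cmod (f k t)}" for n
  have Em[measurable]: "E n \<in> sets circle_measure" for n unfolding E_def by measurable
  have "AE t in circle_measure. t \<notin> (\<Inter>n. E n)"
    using lim
  proof eventually_elim
    case (elim t)
    then have "eventually (\<lambda>n. cmod (f n t) < \<delta>) sequentially"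
      using \<delta> by (auto simp: tendsto_iff)
    then obtain N where "\<forall>n\<ge>N. cmod (f n t) < \<delta>" by (auto simp: eventually_sequentially)
    then have "t \<notin> E N" by (auto simp: E_def not_less intro: less_imp_le)
    then show ?case by blast
  qed
  moreover have "decseq E" by (rule antimonoI) (auto simp: E_def intro: order_trans)
  ultimately obtain n where n: "\<rho> (\<lambda>t. ennreal (h t * indicator (E n) t)) < ennreal (e / 2)"
    using absolutely_continuous_norm[OF sep h, where E=E and e="e / 2"] Em e by auto
  note h(1)[measurable]
  have "bfs_norm \<rho> (f n) \<le> \<rho> (\<lambda>t. ennreal (h t * indicator (E n) t) + ennreal \<delta>)"
    unfolding bfs_norm_def
  proof (rule rho_mono)
    fix t :: complex assume t: "cmod t = 1"
    have "cmod (f n t) \<le> h t * indicator (E n) t + \<delta>"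
      using t f(2)[OF t, of n] \<delta> h(2)[of t] by (auto simp: E_def not_less split: split_indicator)
    then show "ennreal (cmod (f n t)) \<le> ennreal (h t * indicator (E n) t) + ennreal \<delta>"
      using \<delta> h(2)[of t] by (simp add: ennreal_leI flip: ennreal_plus)
  qed (auto simp: L0_plus_def)
  also have "\<dots> \<le> \<rho> (\<lambda>t. ennreal (h t * indicator (E n) t)) + \<rho> (\<lambda>t. ennreal \<delta>)"
    by (intro triangle) (auto simp: L0_plus_def)
  also have "\<dots> \<le> \<rho> (\<lambda>t. ennreal (h t * indicator (E n) t)) + ennreal (e / 2)"
  proof (rule add_left_mono)
    have "\<rho> (\<lambda>t. ennreal \<delta>) \<le> ennreal \<delta> * \<rho> (\<lambda>_. 1)"
      using \<delta> by (intro rho_bounded) (auto simp: L0_plus_def)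
    also have "\<dots> = ennreal (\<delta> * R)" using \<delta> R by (simp add: ennreal_mult)
    also have "\<dots> \<le> ennreal (e / 2)" using \<delta> by (intro ennreal_leI)
    finally show "\<rho> (\<lambda>t. ennreal \<delta>) \<le> ennreal (e / 2)" .
  qed
  also have "\<dots> < ennreal (e / 2) + ennreal (e / 2)"
    using n e
    by (cases "\<rho> (\<lambda>t. ennreal (h t * indicator (E n) t))") (auto simp: ennreal_less_iff simp flip: ennreal_plus)
  also have "\<dots> = ennreal e" using e by (simp flip: ennreal_plus)
  finally show ?thesis by blast
qed

end

section \<open>Convergence of the convolutions\<close>

inductive trig_poly :: "(complex \<Rightarrow> complex) \<Rightarrow> bool" where
  powi: "trig_poly (\<lambda>t. c * t powi k)"
| add: "trig_poly f \<Longrightarrow> trig_poly g \<Longrightarrow> trig_poly (\<lambda>t. f t + g t)"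

lemma trig_poly_cmult: "trig_poly f \<Longrightarrow> trig_poly (\<lambda>t. c * f t)"
proof (induction rule: trig_poly.induct)
  case (powi d k)
  have "(\<lambda>t. c * (d * t powi k)) = (\<lambda>t. (c * d) * t powi k)" by (simp add: mult.assoc)
  then show ?case using trig_poly.powi by metis
next
  case (add f g)
  then show ?case by (simp add: distrib_left trig_poly.add)
qed

lemma trig_poly_shift:
  assumes "trig_poly f"
  shows "\<exists>g. trig_poly g \<and> (\<forall>t. cmod t = 1 \<longrightarrow> t powi m * f t = g t)"
  using assms
proof (induction rule: trig_poly.induct)
  case (powi c k)
  \<comment> \<open>Adding exponents fails at t = 0, which is why equality is claimed on the circle
    only.\<close>
  have "t powi m * (c * t powi k) = c * t powi (m + k)" if "cmod t = 1" for t
  proof -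
    have "t \<noteq> 0" using that by auto
    then show ?thesis by (simp add: power_int_add)
  qed
  then show ?case using trig_poly.powi by blast
next
  case (add f g)
  then obtain f' g' where "trig_poly f'" "\<forall>t. cmod t = 1 \<longrightarrow> t powi m * f t = f' t"
    "trig_poly g'" "\<forall>t. cmod t = 1 \<longrightarrow> t powi m * g t = g' t" by blast
  then show ?case
    by (intro exI[of _ "\<lambda>t. f' t + g' t"]) (simp add: distrib_left trig_poly.add)
qed

text \<open>
  On the circle \<open>Re t\<close> and \<open>Im t\<close> are combinations of \<open>t\<close> and \<open>t\<^sup>-\<^sup>1\<close>; multiplying an
  arbitrary trigonometric polynomial makes the induction over products go through.
\<close>

lemma real_polynomial_function_trig_poly:
  fixes p :: "complex \<Rightarrow> real"
  assumes "real_polynomial_function p" "trig_poly f"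
  shows "\<exists>g. trig_poly g \<and> (\<forall>t. cmod t = 1 \<longrightarrow> of_real (p t) * f t = g t)"
  using assms
proof (induction arbitrary: f rule: real_polynomial_function.induct)
  case (linear p)
  \<comment> \<open>From p(t) = Re t p(1) + Im t p(i) with Re t = (t + 1/t)/2 and Im t = (t -
    1/t)/(2i): a and b are the coefficients of t and 1/t.\<close>
  define a where "a = of_real (p 1) / 2 - \<i> * of_real (p \<i>) / 2"
  define b where "b = of_real (p 1) / 2 + \<i> * of_real (p \<i>) / 2"
  have p: "of_real (p t) = a * t powi 1 + b * t powi (-1)" if "cmod t = 1" for t
  proof -
    interpret bounded_linear p by (rule linear)
    have "p t = p (Re t *\<^sub>R 1 + Im t *\<^sub>R \<i>)"
      by (rule arg_cong[where f=p]) (simp add: complex_eq_iff)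
    also have "\<dots> = Re t * p 1 + Im t * p \<i>" by (simp only: add scaleR real_scaleR_def)
    finally have "p t = Re t * p 1 + Im t * p \<i>" .
    then have "of_real (p t) = a * t + b * cnj t"
      by (simp add: a_def b_def complex_eq_iff field_simps)
    then show ?thesis
      by (simp add: power_int_minus sphere_cnj_inverse[OF that])
  qed
  obtain g1 where g1: "trig_poly g1" "\<And>t. cmod t = 1 \<Longrightarrow> t powi 1 * f t = g1 t"
    using trig_poly_shift[OF linear(2)] by blast
  obtain g2 where g2: "trig_poly g2" "\<And>t. cmod t = 1 \<Longrightarrow> t powi (-1) * f t = g2 t"
    using trig_poly_shift[OF linear(2)] by blast
  have "of_real (p t) * f t = a * g1 t + b * g2 t" if "cmod t = 1" for t
    unfolding p[OF that] g1(2)[OF that, symmetric] g2(2)[OF that, symmetric] by (simp add: algebra_simps)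
  then show ?case
    using g1 g2 by (intro exI[of _ "\<lambda>t. a * g1 t + b * g2 t"]) (auto intro: trig_poly.add trig_poly_cmult)
next
  case (const c)
  then show ?case using trig_poly_cmult[of f "of_real c"] by auto
next
  case (add p q)
  obtain g1 where g1: "trig_poly g1" "\<And>t. cmod t = 1 \<Longrightarrow> of_real (p t) * f t = g1 t"
    using add.IH(1)[OF add.prems] by blast
  obtain g2 where g2: "trig_poly g2" "\<And>t. cmod t = 1 \<Longrightarrow> of_real (q t) * f t = g2 t"
    using add.IH(2)[OF add.prems] by blast
  show ?case
    using g1 g2 by (intro exI[of _ "\<lambda>t. g1 t + g2 t"]) (auto intro: trig_poly.add simp: distrib_right)
next
  case (mult p q)
  obtain g1 where g1: "trig_poly g1" "\<And>t. cmod t = 1 \<Longrightarrow> of_real (q t) * f t = g1 t"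
    using mult.IH(2)[OF mult.prems] by blast
  obtain g2 where g2: "trig_poly g2" "\<And>t. cmod t = 1 \<Longrightarrow> of_real (p t) * g1 t = g2 t"
    using mult.IH(1)[OF g1(1)] by blast
  show ?case
    using g1 g2 by (intro exI[of _ g2]) (simp add: mult.assoc)
qed

lemma tendsto_zero_le_ennreal:
  fixes f g :: "nat \<Rightarrow> ennreal"
  assumes "eventually (\<lambda>n. f n \<le> g n) sequentially" "g \<longlonglongrightarrow> 0"
  shows "f \<longlonglongrightarrow> 0"
  by (rule tendsto_sandwich[OF _ assms(1) tendsto_const assms(2)]) simp

lemma ex_borel_AE_eq:
  assumes "A \<in> sets circle_measure"
  obtains B where "B \<in> sets borel" "AE t in circle_measure. t \<in> B \<longleftrightarrow> t \<in> A"
proof -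
  have A: "A \<in> sets (completion circle_borel)" using assms by (simp add: circle_measure_eq)
  have "main_part circle_borel A \<in> sets (restrict_space borel (sphere 0 1))"
    using main_part_sets[OF A] by (simp add: sets_circle_borel)
  then obtain B where B: "B \<in> sets borel" "main_part circle_borel A = sphere 0 1 \<inter> B"
    by (auto simp: sets_restrict_space)
  have "AE t in circle_measure. t \<in> main_part circle_borel A \<longleftrightarrow> t \<in> A"
    unfolding circle_measure_eq by (rule AE_completion[OF AE_in_main_part[OF A]])
  moreover have "AE t in circle_measure. t \<in> sphere 0 1"
    by (intro AE_I2) simp
  ultimately have "AE t in circle_measure. t \<in> B \<longleftrightarrow> t \<in> A"
    by eventually_elim (auto simp: B)
  with B(1) show ?thesis using that by blast
qed

section \<open>The class of functions to which their convolutions converge\<close>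

context banach_function_norm
begin

definition vp_converges :: "(complex \<Rightarrow> complex) \<Rightarrow> bool" where
  "vp_converges f \<longleftrightarrow> f \<in> bfs \<rho> \<and> (\<lambda>n. bfs_norm \<rho> (\<lambda>t. f t - vp n f t)) \<longlonglongrightarrow> 0"

lemma vp_converges_add:
  assumes "vp_converges f" "vp_converges g"
  shows "vp_converges (\<lambda>t. f t + g t)"
  unfolding vp_converges_def
proof
  have f: "f \<in> bfs \<rho>" "(\<lambda>n. bfs_norm \<rho> (\<lambda>t. f t - vp n f t)) \<longlonglongrightarrow> 0"
    and g: "g \<in> bfs \<rho>" "(\<lambda>n. bfs_norm \<rho> (\<lambda>t. g t - vp n g t)) \<longlonglongrightarrow> 0"
    using assms by (auto simp: vp_converges_def)
  show fg: "(\<lambda>t. f t + g t) \<in> bfs \<rho>" using f g by (intro bfs_add)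
  note m = f(1) g(1) vp_L0[OF f(1)] vp_L0[OF g(1)] vp_L0[OF fg]
  have le: "bfs_norm \<rho> (\<lambda>t. (f t + g t) - vp n (\<lambda>t. f t + g t) t) \<le>
      bfs_norm \<rho> (\<lambda>t. f t - vp n f t) + bfs_norm \<rho> (\<lambda>t. g t - vp n g t)" for n
  proof -
    have "bfs_norm \<rho> (\<lambda>t. (f t + g t) - vp n (\<lambda>t. f t + g t) t) = bfs_norm \<rho> (\<lambda>t. (f t - vp n f t) + (g t - vp n g t))"
      using m vp_add[OF bfs_integrable[OF f(1)] bfs_integrable[OF g(1)]]
      by (intro bfs_norm_cong) (auto simp: L0_def bfs_def)
    also have "\<dots> \<le> bfs_norm \<rho> (\<lambda>t. f t - vp n f t) + bfs_norm \<rho> (\<lambda>t. g t - vp n g t)"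
      using m by (intro bfs_norm_add) (auto simp: L0_def bfs_def)
    finally show ?thesis .
  qed
  have "(\<lambda>n. bfs_norm \<rho> (\<lambda>t. f t - vp n f t) + bfs_norm \<rho> (\<lambda>t. g t - vp n g t)) \<longlonglongrightarrow> 0"
    using tendsto_add[OF f(2) g(2)] by simp
  then show "(\<lambda>n. bfs_norm \<rho> (\<lambda>t. (f t + g t) - vp n (\<lambda>t. f t + g t) t)) \<longlonglongrightarrow> 0"
    by (rule tendsto_zero_le_ennreal[rotated]) (simp add: le)
qed

lemma vp_converges_cmult:
  assumes "vp_converges f"
  shows "vp_converges (\<lambda>t. c * f t)"
  unfolding vp_converges_def
proof
  have f: "f \<in> bfs \<rho>" "(\<lambda>n. bfs_norm \<rho> (\<lambda>t. f t - vp n f t)) \<longlonglongrightarrow> 0"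
    using assms by (auto simp: vp_converges_def)
  show "(\<lambda>t. c * f t) \<in> bfs \<rho>" using f by (intro bfs_cmult)
  have "(\<lambda>t. f t - vp n f t) \<in> L0" for n
    using vp_L0[OF f(1), of n] bfs_measurable[OF f(1)] by (simp add: L0_def)
  then have "bfs_norm \<rho> (\<lambda>t. c * f t - vp n (\<lambda>t. c * f t) t) = ennreal (cmod c) * bfs_norm \<rho> (\<lambda>t. f t - vp n f t)" for n
    by (simp add: vp_cmult bfs_norm_cmult flip: right_diff_distrib)
  moreover have "(\<lambda>n. ennreal (cmod c) * bfs_norm \<rho> (\<lambda>t. f t - vp n f t)) \<longlonglongrightarrow> ennreal (cmod c) * 0"
    using f(2) by (intro ennreal_tendsto_cmult) auto
  ultimately show "(\<lambda>n. bfs_norm \<rho> (\<lambda>t. c * f t - vp n (\<lambda>t. c * f t) t)) \<longlonglongrightarrow> 0" by simp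
qed

lemma L0_powi: "(\<lambda>t. t powi k) \<in> L0"
  unfolding L0_def by (rule borel_imp_circle_measure) measurable

text \<open>For n \<ge> |k| the convolution multiplies the character by one coefficient, so the
  error has constant modulus |1 - coefficient| on the circle.\<close>

lemma vp_converges_powi: "vp_converges (\<lambda>t. t powi k)"
  unfolding vp_converges_def
proof
  show b: "(\<lambda>t. t powi k) \<in> bfs \<rho>"
    by (rule bfs_bounded[where B=1]) (auto simp: L0_powi norm_power_int)
  have "eventually (\<lambda>n. bfs_norm \<rho> (\<lambda>t. t powi k - vp n (\<lambda>t. t powi k) t)
      \<le> \<rho> (\<lambda>_. 1) * ennreal \<bar>1 - vp_coeff n (nat (int n + k))\<bar>) sequentially"
    using eventually_ge_at_top[of "nat \<bar>k\<bar>"]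
  proof eventually_elim
    case (elim n)
    show ?case
      unfolding mult.commute[of "\<rho> _"]
    proof (rule bfs_norm_bounded)
      show "(\<lambda>t. t powi k - vp n (\<lambda>t. t powi k) t) \<in> L0"
        using vp_L0[OF b, of n] L0_powi[of k] by (simp add: L0_def)
      fix t :: complex assume t: "cmod t = 1"
      have "t powi k - vp n (\<lambda>t. t powi k) t = of_real (1 - vp_coeff n (nat (int n + k))) * t powi k"
        unfolding vp_powi[OF t elim] by (simp add: algebra_simps)
      then show "cmod (t powi k - vp n (\<lambda>t. t powi k) t) \<le> \<bar>1 - vp_coeff n (nat (int n + k))\<bar>"
        using t by (simp only: norm_mult norm_of_real norm_power_int power_int_1_left mult_1_right order_refl)
    qed simp
  qed
  moreover have "(\<lambda>n. \<rho> (\<lambda>_. 1) * ennreal \<bar>1 - vp_coeff n (nat (int n + k))\<bar>) \<longlonglongrightarrow> \<rho> (\<lambda>_. 1) * ennreal \<bar>1 - 1\<bar>"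
    using rho_one_finite by (intro ennreal_tendsto_cmult tendsto_ennrealI tendsto_intros tendsto_vp_coeff) auto
  then have "(\<lambda>n. \<rho> (\<lambda>_. 1) * ennreal \<bar>1 - vp_coeff n (nat (int n + k))\<bar>) \<longlonglongrightarrow> 0"
    by simp
  ultimately show "(\<lambda>n. bfs_norm \<rho> (\<lambda>t. t powi k - vp n (\<lambda>t. t powi k) t)) \<longlonglongrightarrow> 0"
    by (rule tendsto_zero_le_ennreal)
qed

lemma vp_converges_trig_poly: "trig_poly f \<Longrightarrow> vp_converges f"
  by (induction rule: trig_poly.induct) (intro vp_converges_cmult vp_converges_powi vp_converges_add; assumption)+

end

section \<open>From trigonometric polynomials to the whole space\<close>

locale bounded_vp = banach_function_norm +
  fixes c :: ennreal
  assumes c_finite: "c < \<infinity>"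
    and vp_norm_le: "f \<in> bfs \<rho> \<Longrightarrow> 0 < r \<Longrightarrow> bfs_norm \<rho> f \<le> ennreal r \<Longrightarrow> bfs_norm \<rho> (vp n f) \<le> c * ennreal r"
    and separable: "bfs_separable \<rho>"
begin

text \<open>The only place where the uniform bound acts: f - g and the convolution of f - g are
  small together, and g converges by assumption.\<close>

lemma vp_converges_limit:
  assumes f: "f \<in> bfs \<rho>"
    and approx: "\<And>e::real. 0 < e \<Longrightarrow> \<exists>g. vp_converges g \<and> bfs_norm \<rho> (\<lambda>t. f t - g t) < ennreal e"
  shows "vp_converges f"
  unfolding vp_converges_def
proof (intro conjI f order_tendstoI)
  fix a :: ennreal assume "0 < a"
  obtain C where C: "c = ennreal C" "0 \<le> C" using c_finite by (cases c) auto
  obtain e where e: "0 < e" "ennreal e \<le> a"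
    using \<open>0 < a\<close> by (cases a) (auto intro: that[of 1])
  \<comment> \<open>The three errors are d, d and C * d, so this choice makes them add up to
    e.\<close>
  define d where "d = e / (2 + C)"
  have "(2 + C) * d = e" using C by (simp add: d_def)
  then have d: "d + d + C * d = e" by (simp add: distrib_right)
  have d0: "0 < d" using e C by (simp add: d_def)
  obtain g where g: "vp_converges g" "bfs_norm \<rho> (\<lambda>t. f t - g t) < ennreal d"
    using approx[OF d0] by blast
  then have gb: "g \<in> bfs \<rho>" and gl: "(\<lambda>n. bfs_norm \<rho> (\<lambda>t. g t - vp n g t)) \<longlonglongrightarrow> 0"
    by (auto simp: vp_converges_def)
  have fgb: "(\<lambda>t. f t - g t) \<in> bfs \<rho>" by (rule bfs_diff[OF f gb])
  have L: "f \<in> L0" "g \<in> L0" "vp n f \<in> L0" "vp n g \<in> L0" "vp n (\<lambda>t. f t - g t) \<in> L0" for n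
    using f gb vp_L0[OF f] vp_L0[OF gb] vp_L0[OF fgb] by (auto simp: bfs_def)
  have "eventually (\<lambda>n. bfs_norm \<rho> (\<lambda>t. g t - vp n g t) < ennreal d) sequentially"
    using order_tendstoD(2)[OF gl] d0 by simp
  then show "eventually (\<lambda>n. bfs_norm \<rho> (\<lambda>t. f t - vp n f t) < a) sequentially"
  proof eventually_elim
    case (elim n)
    have "bfs_norm \<rho> (\<lambda>t. f t - vp n f t) \<le> bfs_norm \<rho> (\<lambda>t. f t - g t) + bfs_norm \<rho> (\<lambda>t. g t - vp n f t)"
      by (intro bfs_norm_triangle L)
    also have "\<dots> \<le> bfs_norm \<rho> (\<lambda>t. f t - g t) + (bfs_norm \<rho> (\<lambda>t. g t - vp n g t) + bfs_norm \<rho> (\<lambda>t. vp n g t - vp n f t))"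
      by (intro add_left_mono bfs_norm_triangle L)
    also have "bfs_norm \<rho> (\<lambda>t. vp n g t - vp n f t) = bfs_norm \<rho> (\<lambda>t. vp n f t - vp n g t)"
      by (rule bfs_norm_minus_commute)
    also have "\<dots> = bfs_norm \<rho> (vp n (\<lambda>t. f t - g t))"
      using L vp_diff[OF bfs_integrable[OF f] bfs_integrable[OF gb]]
      by (intro bfs_norm_cong) (auto simp: L0_def)
    finally have le: "bfs_norm \<rho> (\<lambda>t. f t - vp n f t) \<le>
      bfs_norm \<rho> (\<lambda>t. f t - g t) + (bfs_norm \<rho> (\<lambda>t. g t - vp n g t) + bfs_norm \<rho> (vp n (\<lambda>t. f t - g t)))" .
    have C_le: "bfs_norm \<rho> (vp n (\<lambda>t. f t - g t)) \<le> ennreal (C * d)"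
      using vp_norm_le[OF fgb d0 less_imp_le[OF g(2)]] C d0 by (simp add: ennreal_mult)
    obtain x where x: "bfs_norm \<rho> (\<lambda>t. f t - g t) = ennreal x" "0 \<le> x" "x < d"
      using g(2) d0 by (cases "bfs_norm \<rho> (\<lambda>t. f t - g t)") (auto simp: ennreal_less_iff)
    obtain y where y: "bfs_norm \<rho> (\<lambda>t. g t - vp n g t) = ennreal y" "0 \<le> y" "y < d"
      using elim d0 by (cases "bfs_norm \<rho> (\<lambda>t. g t - vp n g t)") (auto simp: ennreal_less_iff)
    note le
    also have "bfs_norm \<rho> (\<lambda>t. f t - g t) + (bfs_norm \<rho> (\<lambda>t. g t - vp n g t) + bfs_norm \<rho> (vp n (\<lambda>t. f t - g t)))
        \<le> ennreal x + (ennreal y + ennreal (C * d))"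
      unfolding x(1) y(1) by (intro add_left_mono C_le)
    also have "\<dots> = ennreal (x + y + C * d)"
      using x(2) y(2) C d0 by (simp add: add.assoc flip: ennreal_plus)
    also have "\<dots> < ennreal e"
      using x(3) y(3) d e(1) by (intro ennreal_lessI) auto
    finally show ?case using e(2) by simp
  qed
qed simp

text \<open>Together with closedness under norm limits, dominated convergence in X lets the class be
  enlarged by pointwise limits, as in a standard measure-theoretic induction.\<close>

lemma vp_converges_dominated:
  fixes h :: "complex \<Rightarrow> real"
  assumes h: "h \<in> borel_measurable circle_measure" "\<And>t. 0 \<le> h t" "\<rho> (\<lambda>t. ennreal (h t)) < \<infinity>"
    and f: "f \<in> bfs \<rho>" and F: "\<And>n. vp_converges (F n)"
    and le: "\<And>n t. cmod t = 1 \<Longrightarrow> cmod (f t - F n t) \<le> h t"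
    and lim: "AE t in circle_measure. (\<lambda>n::nat. F n t) \<longlonglongrightarrow> f t"
  shows "vp_converges f"
proof (rule vp_converges_limit[OF f])
  fix e :: real assume "0 < e"
  have FL: "F n \<in> L0" for n using F[of n] by (auto simp: vp_converges_def bfs_def)
  have "\<exists>n. bfs_norm \<rho> (\<lambda>t. f t - F n t) < ennreal e"
  proof (rule rho_dominated_convergence[OF separable h _ le _ \<open>0 < e\<close>])
    show "(\<lambda>t. f t - F n t) \<in> L0" for n using FL[of n] bfs_measurable[OF f] by (simp add: L0_def)
    show "AE t in circle_measure. (\<lambda>n. f t - F n t) \<longlonglongrightarrow> 0"
      using lim
    proof eventually_elim
      case (elim t)
      from tendsto_diff[OF tendsto_const[of "f t"] elim] show ?case by simp
    qed
  qed
  then show "\<exists>g. vp_converges g \<and> bfs_norm \<rho> (\<lambda>t. f t - g t) < ennreal e" using F by blast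
qed

lemma vp_converges_dominated_const:
  assumes f: "f \<in> L0" and F: "\<And>n. vp_converges (F n)"
    and le: "\<And>t. cmod t = 1 \<Longrightarrow> cmod (f t) \<le> 1" "\<And>n t. cmod t = 1 \<Longrightarrow> cmod (F n t) \<le> 1"
    and lim: "AE t in circle_measure. (\<lambda>n::nat. F n t) \<longlonglongrightarrow> f t"
  shows "vp_converges f"
proof (rule vp_converges_dominated[where h="\<lambda>_. 2" and F=F])
  have "\<rho> (\<lambda>t. ennreal 2) \<le> ennreal 2 * \<rho> (\<lambda>_. 1)"
    by (intro rho_bounded) (auto simp: L0_plus_def)
  also have "\<dots> < \<infinity>" using rho_one_finite by (auto simp: ennreal_mult_less_top)
  finally show "\<rho> (\<lambda>t. ennreal 2) < \<infinity>" .
  show "f \<in> bfs \<rho>" using f le(1) by (rule bfs_bounded)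
  fix n t assume "cmod t = 1"
  then show "cmod (f t - F n t) \<le> 2"
    using norm_triangle_ineq4[of "f t" "F n t"] le(1)[of t] le(2)[of t n] by simp
qed (use F lim in auto)

lemma vp_converges_cong_AE:
  assumes g: "vp_converges g" and f: "f \<in> L0" and eq: "AE t in circle_measure. f t = g t"
  shows "vp_converges f"
proof (rule vp_converges_limit)
  have gL: "g \<in> L0" and gb: "bfs_norm \<rho> g < \<infinity>" using g by (auto simp: vp_converges_def bfs_def)
  have "bfs_norm \<rho> f = bfs_norm \<rho> g"
    unfolding bfs_norm_def using f gL eq
    by (intro rho_cong_AE) (auto simp: L0_def L0_plus_def elim: eventually_mono)
  then show "f \<in> bfs \<rho>" using f gb by (simp add: bfs_def)
  fix e :: real assume "0 < e"
  have "bfs_norm \<rho> (\<lambda>t. f t - g t) = 0"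
    unfolding bfs_norm_def using f gL eq
    by (subst zero_iff) (auto simp: L0_def L0_plus_def elim: eventually_mono)
  with g \<open>0 < e\<close> show "\<exists>g. vp_converges g \<and> bfs_norm \<rho> (\<lambda>t. f t - g t) < ennreal e" by auto
qed

text \<open>By Stone-Weierstrass a continuous function is uniformly close on the circle to a real
  polynomial in Re and Im, which is a trigonometric polynomial there; a uniform error costs only a
  multiple of the norm of the constant 1.\<close>

lemma vp_converges_continuous:
  fixes \<phi> :: "complex \<Rightarrow> real"
  assumes \<phi>: "continuous_on UNIV \<phi>"
  shows "vp_converges (\<lambda>t. of_real (\<phi> t))"
proof (rule vp_converges_limit)
  have m: "\<psi> \<in> borel_measurable circle_measure" if "continuous_on UNIV \<psi>" for \<psi> :: "complex \<Rightarrow> real"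
    using that by (intro borel_imp_circle_measure borel_measurable_continuous_onI)
  have cont: "continuous_on (sphere 0 1) \<phi>" using \<phi> by (rule continuous_on_subset) simp
  have "bounded (\<phi> ` sphere 0 1)"
    using cont by (intro compact_imp_bounded compact_continuous_image) auto
  then obtain B where B: "\<And>t. cmod t = 1 \<Longrightarrow> \<bar>\<phi> t\<bar> \<le> B"
    using compact_imp_bounded unfolding bounded_iff by fastforce
  show "(\<lambda>t. of_real (\<phi> t)) \<in> bfs \<rho>"
    using B m[OF \<phi>] by (intro bfs_bounded[where B=B]) (auto simp: L0_def)
  fix e :: real assume e: "0 < e"
  obtain R where R: "\<rho> (\<lambda>_. 1) = ennreal R" "0 \<le> R"
    using rho_one_finite by (cases "\<rho> (\<lambda>_. 1)") auto
  define \<delta> where "\<delta> = e / (1 + R)"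
  have \<delta>: "0 < \<delta>" "\<delta> * R < e" using e R by (auto simp: \<delta>_def field_simps)
  obtain p where p: "real_polynomial_function p" "\<And>t. t \<in> sphere 0 1 \<Longrightarrow> \<bar>\<phi> t - p t\<bar> < \<delta>"
    using Stone_Weierstrass_real_polynomial_function[OF compact_sphere cont \<delta>(1)] by blast
  have "trig_poly (\<lambda>t. 1 * t powi 0)" by (rule trig_poly.powi)
  then obtain g where g: "trig_poly g" "\<And>t. cmod t = 1 \<Longrightarrow> of_real (p t) = g t"
    using real_polynomial_function_trig_poly[OF p(1)] by fastforce
  note gc = vp_converges_trig_poly[OF g(1)]
  then have gL: "g \<in> L0" by (auto simp: vp_converges_def bfs_def)
  have "bfs_norm \<rho> (\<lambda>t. of_real (\<phi> t) - g t) \<le> ennreal \<delta> * \<rho> (\<lambda>_. 1)"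
  proof (rule bfs_norm_bounded)
    fix t :: complex assume t: "cmod t = 1"
    have "cmod (of_real (\<phi> t) - g t) = \<bar>\<phi> t - p t\<bar>"
      unfolding g(2)[OF t, symmetric] by (simp flip: of_real_diff)
    then show "cmod (of_real (\<phi> t) - g t) \<le> \<delta>" using p(2)[of t] t by simp
  qed (use gL m[OF \<phi>] \<delta> in \<open>auto simp: L0_def\<close>)
  also have "\<dots> = ennreal (\<delta> * R)" using R \<delta> by (simp add: ennreal_mult)
  also have "\<dots> < ennreal e" using \<delta> e by (intro ennreal_lessI)
  finally show "\<exists>g. vp_converges g \<and> bfs_norm \<rho> (\<lambda>t. of_real (\<phi> t) - g t) < ennreal e"
    using gc by blast
qed

lemma vp_converges_closed:
  assumes F: "closed F"
  shows "vp_converges (indicator F)"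
\<comment> \<open>\<open>infdist\<close> to the empty set is 0 by convention, so the functions
  \<open>u n\<close> below would be constantly 1 instead of tending to 0.\<close>
proof (cases "F = {}")
  case True
  have "(indicator F :: complex \<Rightarrow> complex) = (\<lambda>t. of_real 0)" using True by auto
  then show ?thesis using vp_converges_continuous[of "\<lambda>_. 0"] by simp
next
  case False
  define u where "u n t = max 0 (1 - real n * infdist t F)" for n t
  have u: "0 \<le> u n t" "u n t \<le> 1" for n t
    by (auto simp: u_def infdist_nonneg)
  show ?thesis
  proof (rule vp_converges_dominated_const[where F="\<lambda>n t. of_real (u n t)"])
    show "indicator F \<in> L0"
      unfolding L0_def using F by (intro borel_imp_circle_measure) simp
    show "vp_converges (\<lambda>t. of_real (u n t))" for n
      unfolding u_def by (intro vp_converges_continuous continuous_intros)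
    have "(\<lambda>n. of_real (u n t)) \<longlonglongrightarrow> (indicator F t :: complex)" for t
    proof (cases "t \<in> F")
      case True
      then show ?thesis by (simp add: u_def)
    next
      case False
      then have pos: "0 < infdist t F"
        using in_closed_iff_infdist_zero[OF F \<open>F \<noteq> {}\<close>] infdist_nonneg[of t F] by (simp add: less_le)
      obtain N :: nat where N: "1 / infdist t F < real N" using reals_Archimedean2 by blast
      have "eventually (\<lambda>n. 0 = complex_of_real (u n t)) sequentially"
        using eventually_ge_at_top[of N]
      proof eventually_elim
        case (elim n)
        have "1 < real N * infdist t F" using N pos by (simp add: field_simps)
        also have "\<dots> \<le> real n * infdist t F" using elim pos by (intro mult_right_mono) auto
        finally show ?case by (simp add: u_def)
      qed
      from Lim_transform_eventually[OF tendsto_const this] show ?thesis using False by simp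
    qed
    then show "AE t in circle_measure. (\<lambda>n. of_real (u n t)) \<longlonglongrightarrow> (indicator F t :: complex)"
      by simp
  qed (use u in \<open>auto simp: indicator_def abs_le_iff\<close>)
qed

lemma vp_converges_zero: "vp_converges (\<lambda>t. 0)"
  using vp_converges_continuous[of "\<lambda>_. 0"] by simp

text \<open>Dynkin's argument: closed sets form an intersection-stable generator, complements follow
  by linearity, and disjoint unions by dominated convergence.\<close>

lemma vp_converges_borel_set:
  assumes "A \<in> sets borel"
  shows "vp_converges (indicator A)"
proof -
  have "Int_stable (Collect (closed :: complex set \<Rightarrow> bool))" "Collect closed \<subseteq> Pow (UNIV :: complex set)"
    by (auto simp: Int_stable_def)
  moreover have "A \<in> sigma_sets UNIV (Collect closed)"
    using assms by (simp add: borel_eq_closed)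
  ultimately show ?thesis
  proof (induction rule: sigma_sets_induct_disjoint)
    case (basic A)
    then show ?case by (simp add: vp_converges_closed)
  next
    case empty
    then show ?case by (simp add: vp_converges_zero)
  next
    case (compl A)
    have "vp_converges (\<lambda>t. indicator UNIV t + (-1) * indicator A t)"
      by (intro vp_converges_add vp_converges_cmult compl vp_converges_closed closed_UNIV)
    moreover have "(\<lambda>t. indicator UNIV t + (-1) * indicator A t) = (indicator (UNIV - A) :: complex \<Rightarrow> complex)"
      by (auto simp: fun_eq_iff split: split_indicator)
    ultimately show ?case by simp
  next
    case (union A)
    have Ab: "A i \<in> sets borel" for i using union(2) by (auto simp: borel_eq_closed)
    \<comment> \<open>Disjointness keeps the partial sums indicators, hence bounded by 1, which
      supplies the majorant.\<close>
    have part: "(\<Sum>i<n. indicator (A i) t) = (indicator (\<Union>i<n. A i) t :: complex)" for n t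
      using union(1) by (subst indicator_UN_disjoint) (auto simp: disjoint_family_on_def)
    have conv: "vp_converges (\<lambda>t. \<Sum>i<n. indicator (A i) t)" for n
    proof (induction n)
      case 0
      then show ?case by (simp add: vp_converges_zero)
    next
      case (Suc n)
      then show ?case using vp_converges_add[OF Suc union(3)[of n]] by simp
    qed
    show ?case
    proof (rule vp_converges_dominated_const)
      show "indicator (\<Union>i. A i) \<in> L0"
        unfolding L0_def using Ab by (intro borel_imp_circle_measure) simp
      show "vp_converges (\<lambda>t. \<Sum>i<n. indicator (A i) t)" for n by (rule conv)
      show "cmod (\<Sum>i<n. indicator (A i) t) \<le> 1" for n t
        unfolding part by (simp add: indicator_def)
      show "AE t in circle_measure. (\<lambda>n. \<Sum>i<n. indicator (A i) t) \<longlonglongrightarrow> (indicator (\<Union>i. A i) t :: complex)"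
        unfolding part by (intro AE_I2 LIMSEQ_indicator_UN)
    qed (simp add: indicator_def)
  qed
qed

lemma vp_converges_set:
  assumes A: "A \<in> sets circle_measure"
  shows "vp_converges (indicator A)"
proof -
  obtain B where B: "B \<in> sets borel" "AE t in circle_measure. t \<in> B \<longleftrightarrow> t \<in> A"
    using ex_borel_AE_eq[OF A] .
  show ?thesis
  proof (rule vp_converges_cong_AE[OF vp_converges_borel_set[OF B(1)]])
    show "indicator A \<in> L0" using A by (simp add: L0_def)
    show "AE t in circle_measure. (indicator A t :: complex) = indicator B t"
      using B(2) by eventually_elim (simp add: indicator_def)
  qed
qed

lemma vp_converges_sum:
  "finite I \<Longrightarrow> (\<And>i. i \<in> I \<Longrightarrow> vp_converges (f i)) \<Longrightarrow> vp_converges (\<lambda>t. \<Sum>i\<in>I. f i t)"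
proof (induction rule: finite_induct)
  case empty
  then show ?case by (simp add: vp_converges_zero)
next
  case (insert i I)
  then show ?case by (simp add: vp_converges_add)
qed

lemma vp_converges_simple:
  assumes s: "simple_function circle_measure s"
  shows "vp_converges s"
proof (rule vp_converges_cong_AE)
  let ?A = "\<lambda>y. s -` {y} \<inter> space circle_measure"
  show "vp_converges (\<lambda>t. \<Sum>y\<in>s ` space circle_measure. y * indicator (?A y) t)"
    using simple_functionD[OF s] by (intro vp_converges_sum vp_converges_cmult vp_converges_set)
  show "s \<in> L0" unfolding L0_def using s by (rule borel_measurable_simple_function)
  show "AE t in circle_measure. s t = (\<Sum>y\<in>s ` space circle_measure. y * indicator (?A y) t)"
  proof (rule AE_I2)
    fix t assume t: "t \<in> space circle_measure"
    have "(\<Sum>y\<in>s ` space circle_measure. y * indicator (?A y) t) = (\<Sum>y\<in>s ` space circle_measure. if y = s t then y else 0)"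
      using t by (intro sum.cong) (auto simp del: space_circle_measure split: split_indicator)
    also have "\<dots> = s t" using t simple_functionD(1)[OF s] by (simp del: space_circle_measure)
    finally show "s t = (\<Sum>y\<in>s ` space circle_measure. y * indicator (?A y) t)" ..
  qed
qed

lemma vp_converges_bfs:
  assumes f: "f \<in> bfs \<rho>"
  shows "vp_converges f"
proof -
  note fm = bfs_measurable[OF f]
  \<comment> \<open>Simple functions bounded by 2|f| converge pointwise to f, so the error is
    dominated by 3|f|, which has finite norm.\<close>
  obtain F where F: "\<And>i. simple_function circle_measure (F i)"
    "\<And>t. t \<in> space circle_measure \<Longrightarrow> (\<lambda>i. F i t) \<longlonglongrightarrow> f t"
    "\<And>i t. t \<in> space circle_measure \<Longrightarrow> dist (F i t) 0 \<le> 2 * dist (f t) 0"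
    using borel_measurable_implies_sequence_metric[OF fm, of 0] by blast
  show ?thesis
  proof (rule vp_converges_dominated[where F=F and h="\<lambda>t. 3 * cmod (f t)"])
    have "\<rho> (\<lambda>t. ennreal (3 * cmod (f t))) = ennreal 3 * bfs_norm \<rho> f"
      unfolding bfs_norm_def using fm by (subst homogeneous[symmetric]) (auto simp: L0_plus_def ennreal_mult)
    then show "\<rho> (\<lambda>t. ennreal (3 * cmod (f t))) < \<infinity>"
      using f by (auto simp: bfs_def ennreal_mult_less_top)
    show "(\<lambda>t. 3 * cmod (f t)) \<in> borel_measurable circle_measure" using fm by simp
    fix n t assume "cmod t = 1"
    then show "cmod (f t - F n t) \<le> 3 * cmod (f t)"
      using F(3)[of t n] norm_triangle_ineq4[of "f t" "F n t"] by simp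
  qed (use f F in \<open>auto intro: vp_converges_simple\<close>)
qed

end

section \<open>Hardy functions and analytic polynomials\<close>

text \<open>The multiplier sum runs over frequencies -n..n; the negative ones vanish with the
  Fourier coefficients of f, and \<open>powi\<close> with the remaining exponents is an ordinary
  power.\<close>

lemma vp_hardy_eq_poly:
  assumes f: "integrable circle_measure f" and neg: "\<And>n. n < 0 \<Longrightarrow> fourier_coeff f n = 0"
  obtains q where "\<And>t. cmod t = 1 \<Longrightarrow> vp n f t = poly q t"
proof -
  define q where "q = (\<Sum>k\<le>n. monom (of_real (vp_coeff n (k + n)) * fourier_coeff f (int k)) k)"
  have "vp n f t = poly q t" if t: "cmod t = 1" for t
  proof -
    have "vp n f t = (\<Sum>j\<in>{n..2*n}. of_real (vp_coeff n j) * fourier_coeff f (int j - int n) * t powi (int j - int n))"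
      unfolding vp_eq_sum[OF f t] by (rule sum.mono_neutral_right) (auto simp: neg)
    also have "\<dots> = (\<Sum>k\<le>n. of_real (vp_coeff n (k + n)) * fourier_coeff f (int k) * t ^ k)"
      by (rule sum.reindex_bij_witness[of _ "\<lambda>k. k + n" "\<lambda>j. j - n"]) (auto simp: of_nat_diff simp flip: power_int_of_nat)
    also have "\<dots> = poly q t" by (simp add: q_def poly_sum poly_monom)
    finally show ?thesis .
  qed
  then show ?thesis using that by blast
qed

lemma fourier_coeff_poly_neg:
  assumes "n < 0"
  shows "fourier_coeff (poly p) n = 0"
proof -
  have m: "poly p \<in> borel_measurable circle_measure"
    by (intro borel_imp_circle_measure borel_measurable_continuous_onI continuous_intros)
  have m1: "(\<lambda>s. s powi int i) \<in> borel_measurable circle_measure" for i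
    by (rule borel_imp_circle_measure) measurable
  have int: "integrable circle_measure (\<lambda>s. cnj s powi n * s powi int i)" for i
    by (rule integrable_mult_bounded_circle[OF integrable_powi_circle, where B=1])
      (auto simp: norm_power_int intro: measurable_compose[OF borel_measurable_cnj borel_measurable_powi])
  have "fourier_coeff (poly p) n = (LINT s|circle_measure. (\<Sum>i\<le>degree p. coeff p i * (cnj s powi n * s powi int i)))"
    unfolding fourier_coeff_eq[OF m] by (simp add: poly_altdef sum_distrib_left mult_ac)
  also have "\<dots> = (\<Sum>i\<le>degree p. coeff p i * fourier_coeff (\<lambda>s. s powi int i) n)"
    unfolding fourier_coeff_eq[OF m1] using int
    by (subst Bochner_Integration.integral_sum) (auto simp: mult.commute)
  also have "\<dots> = 0"
    using assms by (intro sum.neutral) (simp add: fourier_coeff_powi del: power_int_of_nat)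
  finally show ?thesis .
qed

theorem theorem1p2:
  fixes \<rho> :: "(complex \<Rightarrow> ennreal) \<Rightarrow> ennreal"
  assumes "banach_function_norm \<rho>"
    and "bfs_separable \<rho>"
    and "hl_maximal_bounded (associate_norm \<rho>)"
  shows "bfs_dense \<rho> analytic_polynomials (hardy_space \<rho>)"
proof -
  interpret banach_function_norm \<rho> by (rule assms(1))
  obtain c where c: "c < \<infinity>" "\<And>g. g \<in> bfs (associate_norm \<rho>) \<Longrightarrow>
      associate_norm \<rho> (hl_maximal g) \<le> c * bfs_norm (associate_norm \<rho>) g"
    using assms(3) unfolding hl_maximal_bounded_def by blast
  interpret bounded_vp \<rho> c
    by unfold_locales (use c(1) assms(2) vp_bounded[OF c(2)] in auto)
  have poly_bfs: "poly p \<in> bfs \<rho>" for p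
  proof -
    have "bounded (poly p ` sphere 0 1)"
      by (intro compact_imp_bounded compact_continuous_image continuous_intros) auto
    then obtain B where "\<forall>z\<in>poly p ` sphere 0 1. cmod z \<le> B"
      unfolding bounded_iff by blast
    then have B: "\<And>t. cmod t = 1 \<Longrightarrow> cmod (poly p t) \<le> B" by auto
    have "poly p \<in> L0"
      unfolding L0_def by (intro borel_imp_circle_measure borel_measurable_continuous_onI continuous_intros)
    then show ?thesis using B by (rule bfs_bounded)
  qed
  show ?thesis
    unfolding bfs_dense_def
  proof (intro conjI ballI allI impI)
    show "analytic_polynomials \<subseteq> hardy_space \<rho>"
      using poly_bfs fourier_coeff_poly_neg by (auto simp: analytic_polynomials_def hardy_space_def)
    fix f and e :: real assume f: "f \<in> hardy_space \<rho>" and e: "0 < e"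
    then have fb: "f \<in> bfs \<rho>" and neg: "\<And>n. n < 0 \<Longrightarrow> fourier_coeff f n = 0"
      by (auto simp: hardy_space_def)
    have "(\<lambda>n. bfs_norm \<rho> (\<lambda>t. f t - vp n f t)) \<longlonglongrightarrow> 0"
      using vp_converges_bfs[OF fb] by (simp add: vp_converges_def)
    from order_tendstoD(2)[OF this, of "ennreal e"] e
    obtain n where n: "bfs_norm \<rho> (\<lambda>t. f t - vp n f t) < ennreal e"
      by (auto simp: eventually_sequentially)
    obtain q where q: "\<And>t. cmod t = 1 \<Longrightarrow> vp n f t = poly q t"
      using vp_hardy_eq_poly[OF bfs_integrable[OF fb] neg, of n] by blast
    \<comment> \<open>The polynomial and the convolution agree on the circle only, and the norm sees
      nothing else.\<close>
    have "bfs_norm \<rho> (\<lambda>t. f t - poly q t) = bfs_norm \<rho> (\<lambda>t. f t - vp n f t)"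
      using bfs_measurable[OF fb] bfs_measurable[OF poly_bfs] vp_L0[OF fb]
      by (intro bfs_norm_cong) (auto simp: L0_def q)
    with n have "bfs_norm \<rho> (\<lambda>t. f t - poly q t) < ennreal e" by simp
    then show "\<exists>d\<in>analytic_polynomials. bfs_norm \<rho> (\<lambda>t. f t - d t) < ennreal e"
      unfolding analytic_polynomials_def by blast
  qed
qed

end
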